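(* Let $(\mathcal S,\mathcal A,\mathbf c,\mathbf P,\gamma)$ be a Turn-Based Deterministic Forward Game (TBDFG) with $n$ states and $m$ actions. The backward SCC propagation algorithm (described in the context) correctly computes the value vector and an optimal strategy profile of the game. Moreover, it requires at most $O(n^3m^2\log^2 n)$ pivot steps of the simplex method.
   Context: TBDG. A turn-based deterministic zero-sum game (TBDG) $(\mathcal S,\mathcal A,\mathbf c,\mathbf P,\gamma)$ has states $\mathcal S=\mathcal S^1\sqcup\mathcal S^2=[n]$ (Player $i$ controls $\mathcal S^i$), actions $\mathcal A=\bigsqcup_{s\in\mathcal S}\mathcal A_s=[m]$ ($\mathcal A_s$ nonempty, the actions playable at $s$), real costs $c_a$, a point-mass transition distribution $\mathbf p_a\in\mathbb R^n$ for each action (so action $a\in\mathcal A_s$ moves deterministically from $s$ to one state), and a discount factor $\gamma\in(0,1)$. Player 1 minimizes and Player 2 maximizes the total discounted cost. The game graph is the directed graph with vertex set $\mathcal S$ and one edge per action $a\in\mathcal A_s$, from $s$ to the state to which $a$ moves. TBDFG. A TBDFG is a TBDG whose game graph contains no directed cycle involving actions of both players (self-loops are allowed directed cycles). Strategies. A strategy of Player $i$ picks one action in $\mathcal A_s$ for each $s\in\mathcal S^i$; a strategy profile is a pair $\pi=(\sigma,\tau)$ of strategies of Players 1 and 2. Its value vector $\mathbf v^\pi$ is the unique solution of $v_s=c_{\pi_s}+\gamma\,\mathbf p_{\pi_s}^T\mathbf v$, $s\in\mathcal S$. A profile $(\sigma,\tau)$ is optimal if $\mathbf v^{(\sigma,\tau')}\le\mathbf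 v^{(\sigma,\tau)}\le\mathbf v^{(\sigma',\tau)}$ componentwise for all strategies $\sigma'$ of Player 1 and $\tau'$ of Player 2. The value vector of the game is $\mathbf v^*=\mathbf v^\pi$ for an optimal $\pi$; equivalently the unique solution of $v^*_s=\min_{a\in\mathcal A_s}\{c_a+\gamma\mathbf p_a^T\mathbf v^*\}$ for $s\in\mathcal S^1$ and $v^*_s=\max_{a\in\mathcal A_s}\{c_a+\gamma\mathbf p_a^T\mathbf v^*\}$ for $s\in\mathcal S^2$. Backward SCC propagation algorithm. (1) Compute the strongly connected components (SCCs) $\mathcal C_1,\dots,\mathcal C_K$ of the game graph and its condensation graph (nodes are the SCCs; there is an edge $(\mathcal C_i,\mathcal C_j)$, $i\ne j$, iff some action moves from a state in $\mathcal C_i$ to a state in $\mathcal C_j$), and relabel the components in a reverse topological order, so that every edge $(\mathcal C_i,\mathcal C_j)$ satisfies $i>j$. (2) For $k=1,\dots,K$ in turn: treat the already computed values of all states in successor components of $\mathcal C_k$ as fixed boundary values (continuation values of actions leaving $\mathcal C_k$), and solve the resulting one-player deterministic Markov decision problem restricted to $\mathcal C_k$ (minimization if its states belong to Player 1, maximization if they belong to Player 2) by the simplex method with the simple pivoting rule. That rule repeatedly switches, at a single state, to the action with the most improving reduced cost, where the reduced cost of $a\in\mathcal A_s$ is $c_a+\gamma\,\mathbf p_a^T\mathbf v-v_s$ for the current values $\mathbf v$: the most negative one for minimization, the most positive one for maximization. It stops when there is no improving action. Store the values $v_s$ and the selected actions $\pi_s$ for $s\in\mathcal C_k$. The output is $(v_s)_{s\in\mathcal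 S}$ and $(\pi_s)_{s\in\mathcal S}$. Each single-state switch counts as one pivot step. $O(\cdot)$ is the usual asymptotic notation with an absolute constant, independent of the costs, of $\gamma$ and of the game. *)

theory Defs
  imports
    Complex_Main
    "HOL-Library.FuncSet"
    "Graph_Theory.Digraph_Component"
begin

section \<open>Turn-based deterministic games\<close>

text \<open>
  States are \<open>{1..n}\<close> and actions are \<open>{1..m}\<close>. The disjoint decomposition of the actions into
  the sets \<open>acts G s\<close> is given by the state \<open>src G a\<close> at which action \<open>a\<close> is playable, and the
  point-mass distribution of action \<open>a\<close> by the state \<open>dest G a\<close> carrying the mass.
\<close>

record game =
  nstates :: nat
  nactions :: nat
  player1 :: "nat set"
  src :: "nat \<Rightarrow> nat"
  dest :: "nat \<Rightarrow> nat"
  cost :: "nat \<Rightarrow> real"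
  discount :: real

definition states :: "game \<Rightarrow> nat set" where
  "states G = {1..nstates G}"

definition actions :: "game \<Rightarrow> nat set" where
  "actions G = {1..nactions G}"

definition player2 :: "game \<Rightarrow> nat set" where
  "player2 G = states G - player1 G"

definition acts :: "game \<Rightarrow> nat \<Rightarrow> nat set" where
  "acts G s = {a \<in> actions G. src G a = s}"

definition trans :: "game \<Rightarrow> nat \<Rightarrow> nat \<Rightarrow> real" where
  "trans G a t = (if t = dest G a then 1 else 0)"

definition tbdg :: "game \<Rightarrow> bool" where
  "tbdg G \<longleftrightarrow>
     player1 G \<subseteq> states G \<and>
     (\<forall>a\<in>actions G. src G a \<in> states G \<and> dest G a \<in> states G) \<and>
     (\<forall>s\<in>states G. acts G s \<noteq> {}) \<and>
     0 < discount G \<and> discount G < 1"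

definition game_graph :: "game \<Rightarrow> (nat, nat) pre_digraph" where
  "game_graph G =
     \<lparr>verts = states G, arcs = actions G, tail = src G, head = dest G\<rparr>"

definition tbdfg :: "game \<Rightarrow> bool" where
  "tbdfg G \<longleftrightarrow> tbdg G \<and>
     \<not> (\<exists>p. pre_digraph.cycle (game_graph G) p \<and>
          (\<exists>a\<in>set p. src G a \<in> player1 G) \<and> (\<exists>b\<in>set p. src G b \<in> player2 G))"


section \<open>Strategies, values and optimality\<close>

definition strategies1 :: "game \<Rightarrow> (nat \<Rightarrow> nat) set" where
  "strategies1 G = (\<Pi>\<^sub>E s\<in>player1 G. acts G s)"

definition strategies2 :: "game \<Rightarrow> (nat \<Rightarrow> nat) set" where
  "strategies2 G = (\<Pi>\<^sub>E s\<in>player2 G. acts G s)"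

definition profile :: "game \<Rightarrow> (nat \<Rightarrow> nat) \<Rightarrow> (nat \<Rightarrow> nat) \<Rightarrow> nat \<Rightarrow> nat" where
  "profile G \<sigma> \<tau> s = (if s \<in> player1 G then \<sigma> s else \<tau> s)"

definition q_value :: "game \<Rightarrow> (nat \<Rightarrow> real) \<Rightarrow> nat \<Rightarrow> real" where
  "q_value G v a = cost G a + discount G * (\<Sum>t\<in>states G. trans G a t * v t)"

text \<open>Vectors indexed by the states are functions that are \<open>undefined\<close> outside \<open>states G\<close>.\<close>

definition value_vector :: "game \<Rightarrow> (nat \<Rightarrow> nat) \<Rightarrow> (nat \<Rightarrow> nat) \<Rightarrow> nat \<Rightarrow> real" where
  "value_vector G \<sigma> \<tau> =
     (THE v. v \<in> extensional (states G) \<and>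
             (\<forall>s\<in>states G. v s = q_value G v (profile G \<sigma> \<tau> s)))"

definition optimal :: "game \<Rightarrow> (nat \<Rightarrow> nat) \<Rightarrow> (nat \<Rightarrow> nat) \<Rightarrow> bool" where
  "optimal G \<sigma> \<tau> \<longleftrightarrow>
     \<sigma> \<in> strategies1 G \<and> \<tau> \<in> strategies2 G \<and>
     (\<forall>\<tau>'\<in>strategies2 G. \<forall>s\<in>states G. value_vector G \<sigma> \<tau>' s \<le> value_vector G \<sigma> \<tau> s) \<and>
     (\<forall>\<sigma>'\<in>strategies1 G. \<forall>s\<in>states G. value_vector G \<sigma> \<tau> s \<le> value_vector G \<sigma>' \<tau> s)"

definition is_game_value :: "game \<Rightarrow> (nat \<Rightarrow> real) \<Rightarrow> bool" where
  "is_game_value G v \<longleftrightarrow> (\<exists>\<sigma> \<tau>. optimal G \<sigma> \<tau> \<and> v = value_vector G \<sigma> \<tau>)"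


section \<open>Backward SCC propagation\<close>

definition condensation_edge :: "game \<Rightarrow> nat set \<Rightarrow> nat set \<Rightarrow> bool" where
  "condensation_edge G C D \<longleftrightarrow>
     C \<in> pre_digraph.sccs_verts (game_graph G) \<and>
     D \<in> pre_digraph.sccs_verts (game_graph G) \<and>
     C \<noteq> D \<and> (\<exists>a\<in>actions G. src G a \<in> C \<and> dest G a \<in> D)"

definition reverse_topological :: "game \<Rightarrow> nat set list \<Rightarrow> bool" where
  "reverse_topological G Cs \<longleftrightarrow>
     distinct Cs \<and> set Cs = pre_digraph.sccs_verts (game_graph G) \<and>
     (\<forall>i<length Cs. \<forall>j<length Cs. condensation_edge G (Cs ! i) (Cs ! j) \<longrightarrow> i > j)"

text \<open>
  Values of the policy \<open>\<pi>\<close> in the one-player problem on component \<open>C\<close>, in which the stored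
  values \<open>w\<close> of the states outside \<open>C\<close> are kept fixed.
\<close>

definition local_value ::
    "game \<Rightarrow> nat set \<Rightarrow> (nat \<Rightarrow> real) \<Rightarrow> (nat \<Rightarrow> nat) \<Rightarrow> nat \<Rightarrow> real" where
  "local_value G C w \<pi> =
     (THE v. (\<forall>s\<in>C. v s = q_value G v (\<pi> s)) \<and> (\<forall>s. s \<notin> C \<longrightarrow> v s = w s))"

definition reduced_cost :: "game \<Rightarrow> (nat \<Rightarrow> real) \<Rightarrow> nat \<Rightarrow> real" where
  "reduced_cost G v a = q_value G v a - v (src G a)"

definition comp_actions :: "game \<Rightarrow> nat set \<Rightarrow> nat set" where
  "comp_actions G C = (\<Union>s\<in>C. acts G s)"

definition improving :: "game \<Rightarrow> nat set \<Rightarrow> (nat \<Rightarrow> real) \<Rightarrow> nat \<Rightarrow> bool" where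
  "improving G C v a \<longleftrightarrow> a \<in> comp_actions G C \<and>
     (if C \<subseteq> player1 G then reduced_cost G v a < 0 else reduced_cost G v a > 0)"

definition most_improving :: "game \<Rightarrow> nat set \<Rightarrow> (nat \<Rightarrow> real) \<Rightarrow> nat \<Rightarrow> bool" where
  "most_improving G C v a \<longleftrightarrow> improving G C v a \<and>
     (\<forall>b\<in>comp_actions G C.
        if C \<subseteq> player1 G then reduced_cost G v a \<le> reduced_cost G v b
        else reduced_cost G v b \<le> reduced_cost G v a)"

text \<open>
  Configurations of the algorithm. In \<open>Between Cs v \<pi> N\<close> the components \<open>Cs\<close> are still to be
  processed, \<open>v\<close> and \<open>\<pi>\<close> hold the values and actions stored so far, and \<open>N\<close> pivot steps have been
  made. In \<open>Solving C Cs v \<pi> N\<close> the simplex method is running on \<open>C\<close> with the current policy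
  \<open>\<pi>\<close>, while \<open>v\<close> still holds the values stored before \<open>C\<close>.
\<close>

datatype config =
    Between "nat set list" "nat \<Rightarrow> real" "nat \<Rightarrow> nat" nat
  | Solving "nat set" "nat set list" "nat \<Rightarrow> real" "nat \<Rightarrow> nat" nat

fun pivots :: "config \<Rightarrow> nat" where
  "pivots (Between Cs v \<pi> N) = N"
| "pivots (Solving C Cs v \<pi> N) = N"

definition initial :: "game \<Rightarrow> config \<Rightarrow> bool" where
  "initial G c \<longleftrightarrow>
     (\<exists>Cs. reverse_topological G Cs \<and> c = Between Cs (\<lambda>_. undefined) (\<lambda>_. undefined) 0)"

text \<open>
  The order of the components, the initial policy of each simplex run and the resolution of ties
  in the pivoting rule are left open. There is no transition into a component that contains states
  of both players.
\<close>

inductive step :: "game \<Rightarrow> config \<Rightarrow> config \<Rightarrow> bool" for G :: game where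
  start: "step G (Between (C # Cs) v \<pi> N) (Solving C Cs v \<pi>' N)"
    if "C \<subseteq> player1 G \<or> C \<subseteq> player2 G"
      and "\<forall>s\<in>C. \<pi>' s \<in> acts G s" and "\<forall>s. s \<notin> C \<longrightarrow> \<pi>' s = \<pi> s"
| pivot: "step G (Solving C Cs v \<pi> N) (Solving C Cs v (\<pi>(src G a := a)) (Suc N))"
    if "most_improving G C (local_value G C v \<pi>) a"
| finish: "step G (Solving C Cs v \<pi> N) (Between Cs (local_value G C v \<pi>) \<pi> N)"
    if "\<not> (\<exists>a. improving G C (local_value G C v \<pi>) a)"

definition reachable_config :: "game \<Rightarrow> config \<Rightarrow> bool" where
  "reachable_config G c \<longleftrightarrow> (\<exists>c0. initial G c0 \<and> (step G)\<^sup>*\<^sup>* c0 c)"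

definition infinite_run :: "game \<Rightarrow> (nat \<Rightarrow> config) \<Rightarrow> bool" where
  "infinite_run G f \<longleftrightarrow> initial G (f 0) \<and> (\<forall>i. step G (f i) (f (Suc i)))"

definition correct_output :: "game \<Rightarrow> (nat \<Rightarrow> real) \<Rightarrow> (nat \<Rightarrow> nat) \<Rightarrow> bool" where
  "correct_output G v \<pi> \<longleftrightarrow>
     is_game_value G v \<and>
     optimal G (restrict \<pi> (player1 G)) (restrict \<pi> (player2 G))"

text \<open>
  Total correctness over all runs: some run can be started, every run ends, and a run can only end
  after the last component, with the correct output.
\<close>

definition correctly_computes :: "game \<Rightarrow> bool" where
  "correctly_computes G \<longleftrightarrow>
     (\<exists>c. initial G c) \<and>
     \<not> (\<exists>f. infinite_run G f) \<and>
     (\<forall>c. reachable_config G c \<and> \<not> (\<exists>c'. step G c c') \<longrightarrow>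
        (\<exists>v \<pi> N. c = Between [] v \<pi> N \<and> correct_output G v \<pi>))"

end

theory Submission
  imports Defs
begin

text \<open>
  The bound is the theorem of Post and Ye on the simplex method for deterministic Markov decision
  processes, applied to one strongly connected component at a time. Their argument is usually
  given in terms of discounted visit counts of the actions. Here it is phrased with values alone:
  for policies \<open>\<pi>\<close>, \<open>\<pi>'\<close> the difference \<open>V \<pi>' - V \<pi>\<close> obeys \<open>d s = g s + \<gamma> * d (f s)\<close>, where
  \<open>f s\<close> is the successor of \<open>s\<close> under \<open>\<pi>'\<close> and \<open>g s\<close> the gain with respect to \<open>\<pi>\<close> of the action that
  \<open>\<pi>'\<close> selects at \<open>s\<close> (\<open>value_difference\<close>).

  The difficulty is that a gain is multiplied by about \<open>1 / (1 - \<gamma>)\<close> when it is collected on a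
  cycle of the policy, but by at most \<open>n\<close> on a path, and the final bound must not involve
  \<open>\<gamma>\<close>. The two scales are therefore treated separately.

  \<^item> A pivot with gain \<open>D\<close> that creates a cycle improves the total value by at least
    \<open>D / (1 - \<gamma>)\<close>, while the distance to the optimum is at most \<open>n * D / (1 - \<gamma>)\<close>. The distance
    thus shrinks by a factor \<open>1 - 1 / n\<close>. After \<open>O(n log n)\<close> creations it has fallen by a factor
    \<open>4 * n\<^sup>2\<close>; then some action selected at the outset cannot be selected any more, or cannot be
    selected on a cycle any more. Hence only \<open>O(m n log n)\<close> pivots create a cycle
    (\<open>created_bound\<close>).
  \<^item> While the set of cycles stays the same, only path states matter, so the distance to the last
    policy of such a stretch is at most \<open>n\<^sup>2 * D\<close>, and a pivot improves the total value by at least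
    \<open>D\<close>. Every \<open>O(n\<^sup>2 log n)\<close> steps some action disappears until the end of the stretch, so the
    stretch has \<open>O(m n\<^sup>2 log n)\<close> pivots (\<open>quiet_length\<close>).
  \<^item> Cycles of a policy are disjoint, so there are at most \<open>n\<close> of them initially, and a pivot
    creates at most one. Hence the pivots that break a cycle without creating one number at most
    \<open>n\<close> plus the number of creations.

  Multiplying the number of stretches by their length gives \<open>O(n\<^sup>3 m\<^sup>2 log\<^sup>2 n)\<close> for one component
  with \<open>m\<close> actions (\<open>run_length\<close>). The action sets of different components are disjoint, so the
  squares of their sizes sum to at most the square of the total, and the bound holds for the
  entire algorithm (\<open>pivot_bound\<close>).

  For correctness, a component with states of both players would contain a simple cycle through
  actions of both, which a forward game excludes (\<open>component_one_player\<close>). Successors of a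
  processed state are processed, so later components leave its optimality equation intact; at the
  end the equations hold at every state, and they certify an optimal profile
  (\<open>optimality_equations_correct\<close>). Termination follows from the bound on the pivots.
\<close>


section \<open>Counting\<close>

lemma finite_maximizer:
  fixes f :: "'x \<Rightarrow> real"
  assumes "finite S" "S \<noteq> {}"
  obtains x where "x \<in> S" "\<And>y. y \<in> S \<Longrightarrow> f y \<le> f x"
proof -
  have "Max (f ` S) \<in> f ` S" using assms by (intro Max_in) auto
  then obtain x where "x \<in> S" "f x = Max (f ` S)" by auto
  then show thesis using assms that[of x] by simp
qed

lemma discrete_ivt_zero:
  fixes c :: "nat \<Rightarrow> nat"
  assumes "c 0 = 0" and "\<And>i. i < L \<Longrightarrow> c (Suc i) \<le> Suc (c i)" and "i \<le> L" and "y \<le> c i"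
  shows "\<exists>j\<le>i. c j = y"
  using assms(3,4)
proof (induction i)
  case 0
  then show ?case using assms(1) by auto
next
  case (Suc i)
  show ?case
  proof (cases "y \<le> c i")
    case True
    with Suc show ?thesis by (meson Suc_leD le_SucI)
  next
    case False
    then have "y = c (Suc i)" using assms(2)[of i] Suc.prems by simp
    then show ?thesis by auto
  qed
qed

text \<open>
  The form in which disappearing actions are counted. The clock \<open>c\<close> counts the events of interest,
  and \<open>P i x\<close> says that \<open>x\<close> is in use at time \<open>i\<close>. If any \<open>l\<close> ticks retire an element that was in
  use when they began, then the retired elements pile up, and there are not enough of them for
  \<open>(card X + 1) * l\<close> ticks.
\<close>

lemma elimination_count:
  fixes c :: "nat \<Rightarrow> nat" and P :: "nat \<Rightarrow> 'x \<Rightarrow> bool"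
  assumes fin: "finite X" and "0 < l"
    and c0: "c 0 = 0" and c1: "\<And>i. i < L \<Longrightarrow> c (Suc i) \<le> Suc (c i)"
    and elim: "\<And>i j. i \<le> j \<Longrightarrow> j \<le> L \<Longrightarrow> c i + l \<le> c j \<Longrightarrow>
      \<exists>x\<in>X. P i x \<and> (\<forall>k. j \<le> k \<and> k \<le> L \<longrightarrow> \<not> P k x)"
  shows "c L < (card X + 1) * l"
proof -
  \<comment> \<open>\<open>E i\<close> holds the elements retired by time \<open>i\<close>; it grows strictly with every \<open>l\<close> ticks.\<close>
  define E where "E i = {x \<in> X. \<forall>k. i \<le> k \<and> k \<le> L \<longrightarrow> \<not> P k x}" for i
  have finE: "finite (E i)" for i
    unfolding E_def using fin by simp
  have "q \<le> card (E i)" if "i \<le> L" "q * l \<le> c i" for q i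
    using that
  proof (induction q arbitrary: i)
    case (Suc q)
    have "q * l \<le> c i" using Suc.prems(2) by simp
    then obtain i' where i': "i' \<le> i" "c i' = q * l"
      using discrete_ivt_zero[of c L i] c0 c1 Suc.prems(1) by blast
    then have "c i' + l \<le> c i" using Suc.prems(2) by simp
    then obtain x where x: "x \<in> X" "P i' x" "\<forall>k. i \<le> k \<and> k \<le> L \<longrightarrow> \<not> P k x"
      using elim[of i' i] i'(1) Suc.prems(1) by blast
    have "x \<in> E i" "x \<notin> E i'"
      using x i'(1) Suc.prems(1) unfolding E_def by auto
    moreover have "E i' \<subseteq> E i" using i'(1) unfolding E_def by auto
    ultimately have "card (E i') < card (E i)"
      by (intro psubset_card_mono finE) blast
    moreover have "q \<le> card (E i')"
      using Suc.IH[of i'] i' Suc.prems(1) by simp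
    ultimately show ?case by simp
  qed simp
  from this[of L "c L div l"] have "c L div l \<le> card (E L)" by simp
  also have "\<dots> \<le> card X"
    unfolding E_def by (intro card_mono fin) auto
  finally have "c L div l < card X + 1" by simp
  then show ?thesis
    using \<open>0 < l\<close> div_less_iff_less_mult by blast
qed

lemma length_le_by_gaps:
  fixes ev :: "nat \<Rightarrow> bool"
  assumes gap: "\<And>a b. a \<le> b \<Longrightarrow> b \<le> L \<Longrightarrow> (\<forall>i. a \<le> i \<and> i < b \<longrightarrow> \<not> ev i) \<Longrightarrow> b - a \<le> B"
  shows "L \<le> (card {i. i < L \<and> ev i} + 1) * (B + 1)"
proof -
  have "b \<le> (card {i. i < b \<and> ev i} + 1) * (B + 1)" if "b \<le> L" for b
    using that
  proof (induction b rule: less_induct)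
    case (less b)
    show ?case
    proof (cases "\<exists>i<b. ev i")
      case False
      then have "b \<le> B" using gap[of 0 b] less.prems by simp
      moreover have no: "{i. i < b \<and> ev i} = {}" using False by blast
      ultimately show ?thesis unfolding no by simp
    next
      case True
      define e where "e = Max {i. i < b \<and> ev i}"
      have ne: "{i. i < b \<and> ev i} \<noteq> {}" and fin: "finite {i. i < b \<and> ev i}"
        using True by auto
      have e: "e < b" "ev e" using Max_in[OF fin ne] unfolding e_def by auto
      have "i \<le> e" if "i < b" "ev i" for i
        using that Max_ge[OF fin] unfolding e_def by auto
      then have "\<forall>i. Suc e \<le> i \<and> i < b \<longrightarrow> \<not> ev i" by (meson not_less_eq_eq)
      then have "b - Suc e \<le> B" using gap[of "Suc e" b] e less.prems by simp
      moreover have "e \<le> (card {i. i < e \<and> ev i} + 1) * (B + 1)"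
        using less.IH[of e] e less.prems by simp
      moreover have "card {i. i < e \<and> ev i} < card {i. i < b \<and> ev i}"
        using e by (intro psubset_card_mono fin) auto
      then have "(card {i. i < e \<and> ev i} + 1 + 1) * (B + 1) \<le> (card {i. i < b \<and> ev i} + 1) * (B + 1)"
        by (intro mult_right_mono) auto
      ultimately show ?thesis by (simp add: algebra_simps)
    qed
  qed
  then show ?thesis by simp
qed

text \<open>
  Turns a contraction factor \<open>1 - 1 / x\<close> into a number of steps: \<open>x * e\<close> of them gain a factor
  \<open>exp e\<close>.
\<close>

lemma exp_scale_le:
  fixes x e :: real
  assumes "1 \<le> x" and "x * e < real l"
  shows "(1 - 1 / x) ^ l < exp (- e)"
proof -
  have "1 - 1 / x \<le> exp (- (1 / x))"
    using exp_ge_add_one_self[of "- (1 / x)"] by simp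
  then have "(1 - 1 / x) ^ l \<le> exp (- (1 / x)) ^ l"
    using assms(1) by (intro power_mono) auto
  also have "\<dots> = exp (- (real l / x))"
    by (simp add: exp_of_nat_mult[symmetric])
  also have "\<dots> < exp (- e)"
    using assms by (simp add: field_simps)
  finally show ?thesis .
qed


section \<open>Discounted inequalities along a map\<close>

text \<open>
  At a state where \<open>d\<close> is maximal the discounted inequality bounds the maximum in terms of itself.
  With \<open>D = 0\<close> this yields comparison and uniqueness of values.
\<close>

lemma discounted_max_principle:
  fixes d :: "'s \<Rightarrow> real"
  assumes "finite Z" and g: "0 \<le> \<gamma>" "\<gamma> < 1"
    and step: "\<And>s. s \<in> Z \<Longrightarrow> d s \<le> D + \<gamma> * d (f s)"
    and exit: "\<And>s. s \<in> Z \<Longrightarrow> f s \<notin> Z \<Longrightarrow> d (f s) \<le> D / (1 - \<gamma>)"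
    and "s \<in> Z"
  shows "d s \<le> D / (1 - \<gamma>)"
proof -
  define M where "M = Max (d ` Z)"
  have upper: "d t \<le> M" if "t \<in> Z" for t
    unfolding M_def using that \<open>finite Z\<close> by simp
  have "M \<in> d ` Z" unfolding M_def using \<open>finite Z\<close> \<open>s \<in> Z\<close> by (intro Max_in) auto
  then obtain t where t: "t \<in> Z" "d t = M" by auto
  have "M \<le> D / (1 - \<gamma>)"
  proof (cases "f t \<in> Z")
    case True
    then have "M \<le> D + \<gamma> * M"
      using step[OF t(1)] t(2) mult_left_mono[OF upper[OF True] g(1)] by linarith
    then show ?thesis using g by (simp add: field_simps)
  next
    case False
    have "M \<le> D + \<gamma> * (D / (1 - \<gamma>))"
      using step[OF t(1)] t(2) mult_left_mono[OF exit[OF t(1) False] g(1)] by linarith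
    also have "\<dots> = D / (1 - \<gamma>)" using g by (simp add: field_simps)
    finally show ?thesis .
  qed
  then show ?thesis using upper[OF \<open>s \<in> Z\<close>] by linarith
qed

text \<open>
  On a set that the map leaves from everywhere, \<open>P\<close> is collected at most once per state, so the
  bound is free of \<open>1 / (1 - \<gamma>)\<close>. In terms of \<open>leaves\<close>, no nonempty subset is closed under the map.
\<close>

lemma transient_bound:
  fixes d :: "'s \<Rightarrow> real"
  assumes fin: "finite T" and g: "0 \<le> \<gamma>" "\<gamma> \<le> 1" and "0 \<le> P" "0 \<le> R"
    and leaves: "\<And>U. U \<subseteq> T \<Longrightarrow> U \<noteq> {} \<Longrightarrow> \<exists>u\<in>U. f u \<notin> U"
    and step: "\<And>s. s \<in> T \<Longrightarrow> d s \<le> P + \<gamma> * d (f s)"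
    and exit: "\<And>s. s \<in> T \<Longrightarrow> f s \<notin> T \<Longrightarrow> d (f s) \<le> R"
    and "s \<in> T"
  shows "d s \<le> R + real (card T) * P"
proof -
  \<comment> \<open>States are peeled off one by one, each time one whose successor has already been bounded.\<close>
  have "\<exists>W\<subseteq>T. card W = k \<and> (\<forall>s\<in>W. d s \<le> R + real k * P)" if "k \<le> card T" for k
    using that
  proof (induction k)
    case (Suc k)
    then obtain W where W: "W \<subseteq> T" "card W = k" "\<forall>s\<in>W. d s \<le> R + real k * P" by auto
    then have "T - W \<noteq> {}" using Suc.prems by (auto simp: fin card_mono)
    then obtain u where u: "u \<in> T - W" "f u \<notin> T - W"
      using leaves[of "T - W"] by auto
    have "d (f u) \<le> R + real k * P"
      using u exit[of u] W(3) mult_nonneg_nonneg[of "real k" P] \<open>0 \<le> P\<close> by fastforce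
    then have "\<gamma> * d (f u) \<le> R + real k * P"
      using g \<open>0 \<le> P\<close> \<open>0 \<le> R\<close>
      by (smt (verit) mult_left_le_one_le mult_left_mono mult_nonneg_nonneg of_nat_0_le_iff)
    then have new: "d u \<le> R + real (Suc k) * P"
      using step[of u] u by (simp add: algebra_simps)
    have "R + real k * P \<le> R + real (Suc k) * P"
      using \<open>0 \<le> P\<close> by (simp add: algebra_simps)
    then have "\<forall>s\<in>insert u W. d s \<le> R + real (Suc k) * P"
      using new W(3) by fastforce
    moreover have "card (insert u W) = Suc k"
      using W u fin finite_subset[OF W(1)] by simp
    moreover have "insert u W \<subseteq> T" using W u by auto
    ultimately show ?case by blast
  qed auto
  from this[of "card T"] obtain W where "W \<subseteq> T" "card W = card T"
    "\<forall>s\<in>W. d s \<le> R + real (card T) * P" by auto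
  then show ?thesis using card_subset_eq[OF fin, of W] \<open>s \<in> T\<close> by auto
qed


section \<open>Cycles of a map\<close>

text \<open>
  A cycle of \<open>f\<close> is represented as a minimal nonempty set closed under \<open>f\<close>. Disjointness of
  cycles and their dependence on \<open>f\<close> inside the cycle alone are then immediate, without iterates.
\<close>

definition cycles :: "'s set \<Rightarrow> ('s \<Rightarrow> 's) \<Rightarrow> 's set set" where
  "cycles C f = {Z. Z \<subseteq> C \<and> Z \<noteq> {} \<and> f ` Z \<subseteq> Z \<and>
     (\<forall>Y. Y \<subseteq> Z \<and> Y \<noteq> {} \<and> f ` Y \<subseteq> Y \<longrightarrow> Y = Z)}"

lemma cyclesD:
  assumes "Z \<in> cycles C f"
  shows "Z \<subseteq> C" "Z \<noteq> {}" "f ` Z \<subseteq> Z"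
  using assms by (simp_all add: cycles_def)

lemma cycles_cong:
  assumes "\<And>s. s \<in> Z \<Longrightarrow> f s = g s"
  shows "Z \<in> cycles C f \<longleftrightarrow> Z \<in> cycles C g"
proof -
  have eq: "f ` Y \<subseteq> Y \<longleftrightarrow> g ` Y \<subseteq> Y" if "Y \<subseteq> Z" for Y
  proof -
    have "f ` Y = g ` Y" using assms that by (intro image_cong) auto
    then show ?thesis by simp
  qed
  show ?thesis
    unfolding cycles_def mem_Collect_eq eq[OF order_refl] using eq by (metis (lifting))
qed

lemma cycle_image_eq:
  assumes "Z \<in> cycles C f"
  shows "f ` Z = Z"
proof -
  from assms have "f ` Z \<subseteq> Z" "Z \<noteq> {}" unfolding cycles_def by auto
  then have "f ` f ` Z \<subseteq> f ` Z" "f ` Z \<noteq> {}" by auto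
  moreover have "\<And>Y. Y \<subseteq> Z \<Longrightarrow> Y \<noteq> {} \<Longrightarrow> f ` Y \<subseteq> Y \<Longrightarrow> Y = Z"
    using assms unfolding cycles_def by simp
  ultimately show ?thesis using \<open>f ` Z \<subseteq> Z\<close> by simp
qed

lemma cycles_disjoint:
  assumes "Y \<in> cycles C f" "Z \<in> cycles C f" "s \<in> Y" "s \<in> Z"
  shows "Y = Z"
proof -
  have "f ` (Y \<inter> Z) \<subseteq> Y \<inter> Z" "Y \<inter> Z \<noteq> {}"
    using assms unfolding cycles_def by auto
  moreover have "\<And>W. W \<subseteq> Y \<Longrightarrow> W \<noteq> {} \<Longrightarrow> f ` W \<subseteq> W \<Longrightarrow> W = Y"
    "\<And>W. W \<subseteq> Z \<Longrightarrow> W \<noteq> {} \<Longrightarrow> f ` W \<subseteq> W \<Longrightarrow> W = Z"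
    using assms(1,2) unfolding cycles_def by simp_all
  ultimately have "Y \<inter> Z = Y" "Y \<inter> Z = Z"
    using Int_lower1[of Y Z] Int_lower2[of Y Z] by (metis, metis)
  then show ?thesis by simp
qed

lemma closed_contains_cycle:
  assumes "finite C" "U \<subseteq> C" "U \<noteq> {}" "f ` U \<subseteq> U"
  shows "\<exists>Z\<in>cycles C f. Z \<subseteq> U"
proof -
  define F where "F = {Y. Y \<subseteq> U \<and> Y \<noteq> {} \<and> f ` Y \<subseteq> Y}"
  have "finite F"
    unfolding F_def using finite_subset[OF assms(2,1)] by simp
  moreover have "U \<in> F" unfolding F_def using assms by simp
  ultimately obtain Z where Z: "Z \<in> F" "\<And>Y. Y \<in> F \<Longrightarrow> Y \<subseteq> Z \<Longrightarrow> Y = Z"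
    using finite_has_minimal2[of F U] by auto
  have "\<forall>Y. Y \<subseteq> Z \<and> Y \<noteq> {} \<and> f ` Y \<subseteq> Y \<longrightarrow> Y = Z"
  proof (intro allI impI)
    fix Y assume Y: "Y \<subseteq> Z \<and> Y \<noteq> {} \<and> f ` Y \<subseteq> Y"
    then have "Y \<in> F" using Z(1) unfolding F_def by blast
    then show "Y = Z" using Z(2) Y by simp
  qed
  then have "Z \<in> cycles C f"
    using Z(1) assms(2) unfolding cycles_def F_def by blast
  then show ?thesis using Z(1) unfolding F_def by auto
qed

lemma finite_cycles: "finite C \<Longrightarrow> finite (cycles C f)"
  by (rule finite_subset[of _ "Pow C"]) (auto simp: cycles_def)

lemma card_cycles_le:
  assumes "finite C"
  shows "card (cycles C f) \<le> card C"
proof (rule card_inj_on_le[OF _ _ assms])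
  define r where "r Z = (SOME s. s \<in> Z)" for Z :: "'a set"
  have r: "r Z \<in> Z" if "Z \<in> cycles C f" for Z
    using that unfolding r_def cycles_def by (auto intro: some_in_eq[THEN iffD2])
  show "inj_on r (cycles C f)"
    by (rule inj_onI) (metis r cycles_disjoint)
  show "r ` cycles C f \<subseteq> C"
    using r unfolding cycles_def by blast
qed

text \<open>
  A map permutes each of its cycles, so the sum of \<open>d (f s)\<close> over the cycle is again the sum of
  \<open>d s\<close>. This is where the factor \<open>1 / (1 - \<gamma>)\<close> enters as an exact value and not only as an
  upper bound.
\<close>

lemma sum_over_cycle:
  fixes d :: "'s \<Rightarrow> real"
  assumes "finite C" "Z \<in> cycles C f" "\<gamma> \<noteq> 1"
    and "\<And>s. s \<in> Z \<Longrightarrow> d s = g s + \<gamma> * d (f s)"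
  shows "sum d Z = sum g Z / (1 - \<gamma>)"
proof -
  have img: "f ` Z = Z" by (rule cycle_image_eq[OF assms(2)])
  have "finite Z" using assms(1,2) finite_subset unfolding cycles_def by auto
  then have "inj_on f Z" using img by (simp add: eq_card_imp_inj_on)
  then have "sum d (f ` Z) = (\<Sum>s\<in>Z. d (f s))" by (simp add: sum.reindex)
  then have "(\<Sum>s\<in>Z. d (f s)) = sum d Z" unfolding img by simp
  moreover have "sum d Z = sum g Z + \<gamma> * (\<Sum>s\<in>Z. d (f s))"
    using assms(4) by (simp add: sum.distrib sum_distrib_left)
  ultimately have "(1 - \<gamma>) * sum d Z = sum g Z" by (simp add: algebra_simps)
  then show ?thesis using assms(3) by (simp add: field_simps)
qed

section \<open>One-player problems\<close>

text \<open>
  A deterministic one-player maximization problem on the states \<open>C\<close>; moves may leave \<open>C\<close>, where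
  the boundary values \<open>w\<close> apply. The value function \<open>V\<close> is a parameter characterized by its
  equations, so that minimization problems are covered by negating costs and values.
\<close>

locale discounted_control =
  fixes C :: "'s set" and Act :: "'s \<Rightarrow> 'a set" and src dst :: "'a \<Rightarrow> 's"
    and c :: "'a \<Rightarrow> real" and \<gamma> :: real and w :: "'s \<Rightarrow> real"
    and V :: "('s \<Rightarrow> 'a) \<Rightarrow> 's \<Rightarrow> real"
  assumes finite_C: "finite C"
    and finite_Act: "s \<in> C \<Longrightarrow> finite (Act s)"
    and Act_nonempty: "s \<in> C \<Longrightarrow> Act s \<noteq> {}"
    and src_Act: "s \<in> C \<Longrightarrow> a \<in> Act s \<Longrightarrow> src a = s"
    and discount: "0 < \<gamma>" "\<gamma> < 1"
    and V_inside: "\<pi> \<in> Pi C Act \<Longrightarrow> s \<in> C \<Longrightarrow> V \<pi> s = c (\<pi> s) + \<gamma> * V \<pi> (dst (\<pi> s))"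
    and V_outside: "\<pi> \<in> Pi C Act \<Longrightarrow> s \<notin> C \<Longrightarrow> V \<pi> s = w s"
begin

definition moves :: "'a set" where
  "moves = (\<Union>s\<in>C. Act s)"

definition gain :: "('s \<Rightarrow> 'a) \<Rightarrow> 'a \<Rightarrow> real" where
  "gain \<pi> a = c a + \<gamma> * V \<pi> (dst a) - V \<pi> (src a)"

definition pivot :: "('s \<Rightarrow> 'a) \<Rightarrow> 'a \<Rightarrow> ('s \<Rightarrow> 'a) \<Rightarrow> bool" where
  "pivot \<pi> a \<pi>' \<longleftrightarrow> a \<in> moves \<and> 0 < gain \<pi> a \<and> (\<forall>b\<in>moves. gain \<pi> b \<le> gain \<pi> a) \<and>
     \<pi>' = \<pi>(src a := a)"

text \<open>
  Progress is measured in this single number, the objective of the linear program that the simplex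
  method solves.
\<close>

definition gap :: "('s \<Rightarrow> 'a) \<Rightarrow> ('s \<Rightarrow> 'a) \<Rightarrow> real" where
  "gap \<pi> \<pi>' = (\<Sum>s\<in>C. V \<pi>' s - V \<pi> s)"

definition policy_cycles :: "('s \<Rightarrow> 'a) \<Rightarrow> 's set set" where
  "policy_cycles \<pi> = cycles C (\<lambda>s. dst (\<pi> s))"

definition cyclic :: "('s \<Rightarrow> 'a) \<Rightarrow> 's set" where
  "cyclic \<pi> = \<Union> (policy_cycles \<pi>)"

lemma finite_moves: "finite moves"
  unfolding moves_def using finite_C finite_Act by simp

lemma policy_moves: "\<pi> \<in> Pi C Act \<Longrightarrow> s \<in> C \<Longrightarrow> \<pi> s \<in> moves"
  unfolding moves_def by auto

lemma src_policy: "\<pi> \<in> Pi C Act \<Longrightarrow> s \<in> C \<Longrightarrow> src (\<pi> s) = s"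
  using src_Act by auto

lemma moves_src: "a \<in> moves \<Longrightarrow> src a \<in> C \<and> a \<in> Act (src a)"
  unfolding moves_def using src_Act by auto

lemma gain_own: "\<pi> \<in> Pi C Act \<Longrightarrow> s \<in> C \<Longrightarrow> gain \<pi> (\<pi> s) = 0"
  unfolding gain_def using V_inside src_policy by simp

text \<open>
  The identity on which everything below rests. Exchanging the roles of the two policies expresses
  the same difference by the losses \<open>- gain \<pi>' (\<pi> s)\<close> along the moves of \<open>\<pi>\<close>.
\<close>

lemma value_difference:
  assumes "\<pi> \<in> Pi C Act" "\<pi>' \<in> Pi C Act" "s \<in> C"
  shows "V \<pi>' s - V \<pi> s =
    gain \<pi> (\<pi>' s) + \<gamma> * (V \<pi>' (dst (\<pi>' s)) - V \<pi> (dst (\<pi>' s)))"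
  using V_inside[OF assms(2,3)] src_policy[OF assms(2,3)]
  unfolding gain_def by (simp add: algebra_simps)

lemma value_difference_le:
  assumes "\<pi> \<in> Pi C Act" "\<pi>' \<in> Pi C Act" "0 \<le> D" "\<And>s. s \<in> C \<Longrightarrow> gain \<pi> (\<pi>' s) \<le> D"
  shows "V \<pi>' s - V \<pi> s \<le> D / (1 - \<gamma>)"
proof (cases "s \<in> C")
  case True
  show ?thesis
  proof (rule discounted_max_principle[where Z = C and \<gamma> = \<gamma> and f = "\<lambda>s. dst (\<pi>' s)"
        and d = "\<lambda>s. V \<pi>' s - V \<pi> s"])
    show "V \<pi>' t - V \<pi> t \<le> D + \<gamma> * (V \<pi>' (dst (\<pi>' t)) - V \<pi> (dst (\<pi>' t)))" if "t \<in> C" for t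
      using value_difference[OF assms(1,2) that] assms(4)[OF that] by simp
    show "V \<pi>' (dst (\<pi>' t)) - V \<pi> (dst (\<pi>' t)) \<le> D / (1 - \<gamma>)"
      if "dst (\<pi>' t) \<notin> C" for t
      using V_outside[OF assms(1) that] V_outside[OF assms(2) that] assms(3) discount by simp
  qed (use True finite_C discount in auto)
next
  case False
  then show ?thesis using V_outside assms discount by simp
qed

lemma value_difference_ge_0:
  assumes "\<pi> \<in> Pi C Act" "\<pi>' \<in> Pi C Act" "\<And>s. s \<in> C \<Longrightarrow> 0 \<le> gain \<pi> (\<pi>' s)"
  shows "V \<pi> s \<le> V \<pi>' s"
proof (cases "s \<in> C")
  case True
  have "V \<pi> s - V \<pi>' s \<le> 0 / (1 - \<gamma>)"
  proof (rule discounted_max_principle[where Z = C and \<gamma> = \<gamma> and f = "\<lambda>s. dst (\<pi>' s)"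
        and d = "\<lambda>s. V \<pi> s - V \<pi>' s"])
    show "V \<pi> t - V \<pi>' t \<le> 0 + \<gamma> * (V \<pi> (dst (\<pi>' t)) - V \<pi>' (dst (\<pi>' t)))" if "t \<in> C" for t
      using value_difference[OF assms(1,2) that] assms(3)[OF that] by (simp add: algebra_simps)
    show "V \<pi> (dst (\<pi>' t)) - V \<pi>' (dst (\<pi>' t)) \<le> 0 / (1 - \<gamma>)" if "dst (\<pi>' t) \<notin> C" for t
      using V_outside[OF assms(1) that] V_outside[OF assms(2) that] by simp
  qed (use True finite_C discount in auto)
  then show ?thesis by simp
next
  case False
  then show ?thesis using V_outside assms by simp
qed

lemma value_le_by_agreement:
  assumes "\<pi> \<in> Pi C Act" "\<pi>' \<in> Pi C Act" "Z \<subseteq> C"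
    and "\<And>s. s \<in> Z \<Longrightarrow> \<pi>' s = \<pi> s" "\<And>s. s \<in> Z \<Longrightarrow> dst (\<pi>' s) \<in> Z" "s \<in> Z"
  shows "V \<pi>' s - V \<pi> s \<le> 0"
proof -
  have "V \<pi>' s - V \<pi> s \<le> 0 / (1 - \<gamma>)"
  proof (rule discounted_max_principle[where Z = Z and \<gamma> = \<gamma> and f = "\<lambda>s. dst (\<pi>' s)"
        and d = "\<lambda>s. V \<pi>' s - V \<pi> s"])
    show "V \<pi>' t - V \<pi> t \<le> 0 + \<gamma> * (V \<pi>' (dst (\<pi>' t)) - V \<pi> (dst (\<pi>' t)))" if "t \<in> Z" for t
      using value_difference[OF assms(1,2), of t] assms(3,4) that gain_own[OF assms(1), of t] by auto
    show "finite Z" using finite_subset[OF assms(3) finite_C] .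
  qed (use assms discount in auto)
  then show ?thesis by simp
qed

text \<open>
  If \<open>\<rho>\<close> dominates \<open>\<pi>\<close>, then an action of \<open>\<pi>\<close> that is bad with respect to \<open>\<rho>\<close> keeps \<open>\<pi>\<close> at least that
  far below \<open>\<rho>\<close>. Once a policy is closer to \<open>\<rho>\<close> than this, it cannot select the action.
\<close>

lemma loss_le_difference:
  assumes "\<rho> \<in> Pi C Act" "\<pi> \<in> Pi C Act" "\<And>t. V \<pi> t \<le> V \<rho> t" "s \<in> C"
  shows "- gain \<rho> (\<pi> s) \<le> V \<rho> s - V \<pi> s"
proof -
  have "0 \<le> \<gamma> * (V \<rho> (dst (\<pi> s)) - V \<pi> (dst (\<pi> s)))"
    using discount assms(3) by simp
  then show ?thesis
    using value_difference[OF assms(1,2,4)] unfolding right_diff_distrib by linarith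
qed

lemma switch_policy:
  assumes "\<pi> \<in> Pi C Act" "a \<in> moves"
  shows "\<pi>(src a := a) \<in> Pi C Act"
  using assms moves_src[OF assms(2)] by auto

lemma switch_improves:
  assumes "\<pi> \<in> Pi C Act" "a \<in> moves" "0 \<le> gain \<pi> a"
  shows "V \<pi> s \<le> V (\<pi>(src a := a)) s"
    and "gain \<pi> a \<le> V (\<pi>(src a := a)) (src a) - V \<pi> (src a)"
proof -
  have pol: "\<pi>(src a := a) \<in> Pi C Act" by (rule switch_policy[OF assms(1,2)])
  show mono: "V \<pi> s \<le> V (\<pi>(src a := a)) s" for s
    by (rule value_difference_ge_0[OF assms(1) pol]) (auto simp: gain_own[OF assms(1)] assms(3))
  show "gain \<pi> a \<le> V (\<pi>(src a := a)) (src a) - V \<pi> (src a)"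
    using value_difference[OF assms(1) pol, of "src a"] moves_src[OF assms(2)]
      mult_nonneg_nonneg[of \<gamma> "V (\<pi>(src a := a)) (dst a) - V \<pi> (dst a)"] mono[of "dst a"] discount
    by simp
qed

text \<open>
  A policy of maximal total value admits no improving switch. Policies are arbitrary outside \<open>C\<close>, so
  the maximum is taken over the finitely many extensional ones.
\<close>

lemma optimal_policy_exists:
  obtains \<pi>' where "\<pi>' \<in> Pi C Act" "\<And>a. a \<in> moves \<Longrightarrow> gain \<pi>' a \<le> 0"
proof -
  define F where "F = PiE C Act"
  have "finite F" "F \<noteq> {}"
    unfolding F_def using finite_C finite_Act Act_nonempty by (auto intro: finite_PiE simp: PiE_eq_empty_iff)
  then obtain \<pi> where \<pi>: "\<pi> \<in> F" "\<And>\<rho>. \<rho> \<in> F \<Longrightarrow> (\<Sum>s\<in>C. V \<rho> s) \<le> (\<Sum>s\<in>C. V \<pi> s)"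
    using finite_maximizer[of F "\<lambda>\<rho>. \<Sum>s\<in>C. V \<rho> s"] by blast
  have pol: "\<pi> \<in> Pi C Act" using \<pi>(1) unfolding F_def by (auto simp: PiE_def)
  have "gain \<pi> a \<le> 0" if a: "a \<in> moves" for a
  proof (rule ccontr)
    assume "\<not> gain \<pi> a \<le> 0"
    then have pos: "0 < gain \<pi> a" by simp
    have "src a \<in> C" "a \<in> Act (src a)" using moves_src[OF a] by auto
    then have "\<pi>(src a := a) \<in> F"
      using \<pi>(1) unfolding F_def by (auto simp: PiE_def extensional_def)
    then have "(\<Sum>s\<in>C. V (\<pi>(src a := a)) s) \<le> (\<Sum>s\<in>C. V \<pi> s)" by (rule \<pi>(2))
    moreover have "(\<Sum>s\<in>C. V \<pi> s) < (\<Sum>s\<in>C. V (\<pi>(src a := a)) s)"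
    proof (rule sum_strict_mono_ex1[OF finite_C])
      show "\<forall>s\<in>C. V \<pi> s \<le> V (\<pi>(src a := a)) s"
        using switch_improves(1)[OF pol a] pos by simp
      show "\<exists>s\<in>C. V \<pi> s < V (\<pi>(src a := a)) s"
        using switch_improves(2)[OF pol a] pos \<open>src a \<in> C\<close> by force
    qed
    ultimately show False by simp
  qed
  then show thesis using that pol by blast
qed

lemma cyclic_subset: "cyclic \<pi> \<subseteq> C"
  unfolding cyclic_def policy_cycles_def using cyclesD(1) by blast

lemma cyclic_closed: "s \<in> cyclic \<pi> \<Longrightarrow> dst (\<pi> s) \<in> cyclic \<pi>"
  unfolding cyclic_def policy_cycles_def using cyclesD(3) by blast

text \<open>
  States off the cycles contain no closed nonempty set, since such a set would contain a cycle;
  hence at most \<open>n\<close> times the per-step bound \<open>P\<close> is added to the bound \<open>R\<close> that holds on the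
  cycles and outside \<open>C\<close>.
\<close>

lemma transient_difference_bound:
  fixes d :: "'s \<Rightarrow> real"
  assumes "0 \<le> P" "0 \<le> R" "card C \<le> n"
    and step: "\<And>s. s \<in> C \<Longrightarrow> s \<notin> cyclic \<pi> \<Longrightarrow> d s \<le> P + \<gamma> * d (dst (\<pi> s))"
    and cyc: "\<And>s. s \<in> cyclic \<pi> \<Longrightarrow> d s \<le> R"
    and out: "\<And>s. s \<notin> C \<Longrightarrow> d s \<le> R"
    and "s \<in> C"
  shows "d s \<le> R + real n * P"
proof (cases "s \<in> cyclic \<pi>")
  case True
  then show ?thesis using cyc assms(1) by (smt (verit) mult_nonneg_nonneg of_nat_0_le_iff)
next
  case False
  have "d s \<le> R + real (card (C - cyclic \<pi>)) * P"
  proof (rule transient_bound[where f = "\<lambda>s. dst (\<pi> s)" and \<gamma> = \<gamma>])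
    fix U assume U: "U \<subseteq> C - cyclic \<pi>" "U \<noteq> {}"
    show "\<exists>u\<in>U. dst (\<pi> u) \<notin> U"
    proof (rule ccontr)
      assume "\<not> (\<exists>u\<in>U. dst (\<pi> u) \<notin> U)"
      then have "(\<lambda>s. dst (\<pi> s)) ` U \<subseteq> U" by auto
      then obtain Z where Z: "Z \<in> policy_cycles \<pi>" "Z \<subseteq> U"
        using closed_contains_cycle[OF finite_C, of U "\<lambda>s. dst (\<pi> s)"] U
        unfolding policy_cycles_def by auto
      then have "Z \<noteq> {}" "Z \<subseteq> cyclic \<pi>"
        using cyclesD(2)[of Z C "\<lambda>s. dst (\<pi> s)"] unfolding cyclic_def policy_cycles_def by auto
      then show False using Z(2) U(1) by blast
    qed
  qed (use False assms finite_C discount in auto)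
  also have "real (card (C - cyclic \<pi>)) * P \<le> real n * P"
    using assms(1,3) card_mono[OF finite_C, of "C - cyclic \<pi>"] by (intro mult_right_mono) auto
  finally show ?thesis by simp
qed

end


section \<open>Runs of the simplex method\<close>

locale simplex_run = discounted_control C Act src dst c \<gamma> w V
  for C :: "'s set" and Act :: "'s \<Rightarrow> 'a set" and src dst :: "'a \<Rightarrow> 's"
    and c :: "'a \<Rightarrow> real" and \<gamma> :: real and w :: "'s \<Rightarrow> real"
    and V :: "('s \<Rightarrow> 'a) \<Rightarrow> 's \<Rightarrow> real" +
  fixes p :: "nat \<Rightarrow> 's \<Rightarrow> 'a" and a :: "nat \<Rightarrow> 'a" and L n :: nat
  assumes start: "p 0 \<in> Pi C Act"
    and pivots: "i < L \<Longrightarrow> pivot (p i) (a i) (p (Suc i))"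
    and card_C: "card C \<le> n"
    and n_ge: "2 \<le> n"
begin

abbreviation creating :: "nat \<Rightarrow> bool" where
  "creating i \<equiv> src (a i) \<in> cyclic (p (Suc i))"

abbreviation breaking :: "nat \<Rightarrow> bool" where
  "breaking i \<equiv> src (a i) \<in> cyclic (p i)"

lemma p_Suc: "i < L \<Longrightarrow> p (Suc i) = (p i)(src (a i) := a i)"
  using pivots unfolding pivot_def by blast

lemma a_move: "i < L \<Longrightarrow> a i \<in> moves"
  using pivots unfolding pivot_def by blast

lemma gain_pos: "i < L \<Longrightarrow> 0 < gain (p i) (a i)"
  using pivots unfolding pivot_def by blast

lemma gain_max: "i < L \<Longrightarrow> b \<in> moves \<Longrightarrow> gain (p i) b \<le> gain (p i) (a i)"
  using pivots unfolding pivot_def by blast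

lemma policy: "i \<le> L \<Longrightarrow> p i \<in> Pi C Act"
proof (induction i)
  case (Suc i)
  then show ?case using p_Suc[of i] switch_policy[OF _ a_move[of i], of "p i"] by (simp del: fun_upd_apply)
qed (simp add: start)

lemma value_Suc_ge: "i < L \<Longrightarrow> V (p i) s \<le> V (p (Suc i)) s"
  using switch_improves(1)[of "p i" "a i" s] policy[of i] a_move[of i] gain_pos[of i] p_Suc[of i] by simp

lemma value_Suc_gain: "i < L \<Longrightarrow> gain (p i) (a i) \<le> V (p (Suc i)) (src (a i)) - V (p i) (src (a i))"
  using switch_improves(2)[of "p i" "a i"] policy[of i] a_move[of i] gain_pos[of i] p_Suc[of i] by simp

lemma value_mono:
  assumes "i \<le> j" "j \<le> L"
  shows "V (p i) s \<le> V (p j) s"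
  using assms
proof (induction j rule: dec_induct)
  case (step j)
  then show ?case using value_Suc_ge[of j s] by simp
qed simp

lemma gap_Suc:
  assumes "i < L"
  shows "gap (p i) \<rho> - gap (p (Suc i)) \<rho> = (\<Sum>s\<in>C. V (p (Suc i)) s - V (p i) s)"
  unfolding gap_def by (simp add: sum_subtractf[symmetric])

lemma gap_Suc_gain:
  assumes "i < L"
  shows "gap (p (Suc i)) \<rho> \<le> gap (p i) \<rho> - gain (p i) (a i)"
proof -
  have "gain (p i) (a i) \<le> (\<Sum>s\<in>C. V (p (Suc i)) s - V (p i) s)"
    using member_le_sum[of "src (a i)" C "\<lambda>s. V (p (Suc i)) s - V (p i) s"]
      value_Suc_gain[OF assms] value_Suc_ge[OF assms] moves_src[OF a_move[OF assms]] finite_C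
    by fastforce
  then show ?thesis using gap_Suc[OF assms, of \<rho>] by simp
qed

lemma gap_mono:
  assumes "i \<le> j" "j \<le> L"
  shows "gap (p j) \<rho> \<le> gap (p i) \<rho>"
  unfolding gap_def using value_mono[OF assms] by (intro sum_mono) simp

lemma gap_pos:
  assumes "i < L" "\<And>s. V (p (Suc i)) s \<le> V \<rho> s"
  shows "0 < gap (p i) \<rho>"
proof -
  have "0 \<le> gap (p (Suc i)) \<rho>"
    unfolding gap_def using assms(2) by (intro sum_nonneg) simp
  then show ?thesis using gap_Suc_gain[OF assms(1), of \<rho>] gain_pos[OF assms(1)] by simp
qed

lemma value_le_gap:
  assumes "s \<in> C" "\<And>s. V \<pi> s \<le> V \<rho> s"
  shows "V \<rho> s - V \<pi> s \<le> gap \<pi> \<rho>"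
  unfolding gap_def using assms finite_C
  by (intro member_le_sum[where f = "\<lambda>s. V \<rho> s - V \<pi> s"]) auto

lemma gap_le:
  assumes "\<And>s. s \<in> C \<Longrightarrow> V \<rho> s - V \<pi> s \<le> D" "0 \<le> D"
  shows "gap \<pi> \<rho> \<le> real n * D"
proof -
  have "gap \<pi> \<rho> \<le> real (card C) * D"
    unfolding gap_def using sum_bounded_above[of C "\<lambda>s. V \<rho> s - V \<pi> s" D] assms(1) by simp
  also have "\<dots> \<le> real n * D" using card_C assms(2) by (intro mult_right_mono) auto
  finally show ?thesis .
qed


subsection \<open>Stretches without a change of cycles\<close>

lemma cycles_Suc_avoiding:
  assumes "i < L" "src (a i) \<notin> Z"
  shows "Z \<in> policy_cycles (p (Suc i)) \<longleftrightarrow> Z \<in> policy_cycles (p i)"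
  unfolding policy_cycles_def using p_Suc[OF assms(1)] assms(2) by (intro cycles_cong) auto

definition quiet :: "nat \<Rightarrow> nat \<Rightarrow> bool" where
  "quiet i j \<longleftrightarrow> (\<forall>k. i \<le> k \<and> k < j \<longrightarrow> \<not> creating k \<and> \<not> breaking k)"

lemma quiet_same_cycles:
  assumes "i \<le> j" "j \<le> L" "quiet i j"
  shows "cyclic (p j) = cyclic (p i)" and "s \<in> cyclic (p i) \<Longrightarrow> p j s = p i s"
proof -
  have "policy_cycles (p j) = policy_cycles (p i) \<and> (\<forall>s\<in>cyclic (p i). p j s = p i s)"
    using assms
  proof (induction j rule: dec_induct)
    case (step j)
    then have IH: "policy_cycles (p j) = policy_cycles (p i)" "\<forall>s\<in>cyclic (p i). p j s = p i s"
      and no: "\<not> creating j" "\<not> breaking j"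
      unfolding quiet_def by auto
    have "Z \<in> policy_cycles (p (Suc j)) \<longleftrightarrow> Z \<in> policy_cycles (p j)" for Z
      using cycles_Suc_avoiding[of j Z] no step.prems unfolding cyclic_def by fastforce
    then have "policy_cycles (p (Suc j)) = policy_cycles (p j)" by blast
    moreover have "p (Suc j) s = p j s" if "s \<in> cyclic (p j)" for s
      using that no p_Suc[of j] step.prems by auto
    moreover have "cyclic (p j) = cyclic (p i)" unfolding cyclic_def IH(1) ..
    ultimately show ?case using IH by auto
  qed simp
  then show "cyclic (p j) = cyclic (p i)" and "s \<in> cyclic (p i) \<Longrightarrow> p j s = p i s"
    unfolding cyclic_def by auto
qed

text \<open>
  The policy does not change on its cycles, and these are closed, so their values are frozen during a
  quiet stretch.
\<close>

lemma quiet_cyclic_values: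
  assumes "i \<le> j" "j \<le> L" "quiet i j" "s \<in> cyclic (p i)"
  shows "V (p j) s - V (p i) s \<le> 0"
proof (rule value_le_by_agreement[where Z = "cyclic (p i)"])
  show "dst (p j t) \<in> cyclic (p i)" if "t \<in> cyclic (p i)" for t
    using cyclic_closed[of t "p j"] quiet_same_cycles(1)[OF assms(1-3)] that by simp
qed (use assms policy cyclic_subset quiet_same_cycles[OF assms(1-3)] in auto)

text \<open>
  With frozen cycles the two policies differ only along paths, where the largest gain counts at most
  \<open>n\<close> times per state.
\<close>

lemma quiet_gap_le_gain:
  assumes "i \<le> j" "j \<le> L" "quiet i j" "0 \<le> D" "\<And>b. b \<in> moves \<Longrightarrow> gain (p i) b \<le> D"
  shows "gap (p i) (p j) \<le> real n ^ 2 * D"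
proof -
  have pol: "p i \<in> Pi C Act" "p j \<in> Pi C Act" using policy assms(1,2) by auto
  have "V (p j) s - V (p i) s \<le> 0 + real n * D" if "s \<in> C" for s
  proof (rule transient_difference_bound[where \<pi> = "p j" and d = "\<lambda>s. V (p j) s - V (p i) s",
        OF assms(4) order_refl card_C])
    show "V (p j) t - V (p i) t \<le> D + \<gamma> * (V (p j) (dst (p j t)) - V (p i) (dst (p j t)))"
      if "t \<in> C" for t
      using value_difference[OF pol that] assms(5)[OF policy_moves[OF pol(2) that]] by simp
    show "V (p j) t - V (p i) t \<le> 0" if "t \<in> cyclic (p j)" for t
      using quiet_cyclic_values[OF assms(1-3)] quiet_same_cycles(1)[OF assms(1-3)] that by simp
    show "V (p j) t - V (p i) t \<le> 0" if "t \<notin> C" for t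
      using V_outside pol that by simp
  qed (use that in auto)
  then have "gap (p i) (p j) \<le> real n * (real n * D)"
    using assms(4) by (intro gap_le) auto
  then show ?thesis by (simp add: power2_eq_square)
qed

text \<open>
  The counterpart of the previous bound with the roles exchanged: some single action of the earlier
  policy is responsible for a fraction \<open>1 / n\<^sup>2\<close> of the distance, measured by its loss with
  respect to the last policy.
\<close>

lemma quiet_gap_le_loss:
  assumes "i \<le> j" "j \<le> L" "quiet i j" "0 < gap (p i) (p j)"
  obtains s where "s \<in> C" "gap (p i) (p j) \<le> real n ^ 2 * (- gain (p j) (p i s))"
proof -
  have pol: "p i \<in> Pi C Act" "p j \<in> Pi C Act" using policy assms(1,2) by auto
  have "C \<noteq> {}" using assms(4) unfolding gap_def by auto
  then obtain s where s: "s \<in> C" "\<And>t. t \<in> C \<Longrightarrow> - gain (p j) (p i t) \<le> - gain (p j) (p i s)"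
    using finite_maximizer[OF finite_C, of "\<lambda>s. - gain (p j) (p i s)"] by blast
  define P where "P = max 0 (- gain (p j) (p i s))"
  have "V (p j) t - V (p i) t \<le> 0 + real n * P" if "t \<in> C" for t
  proof (rule transient_difference_bound[where \<pi> = "p i" and d = "\<lambda>s. V (p j) s - V (p i) s",
        OF _ order_refl card_C])
    show "V (p j) t - V (p i) t \<le> P + \<gamma> * (V (p j) (dst (p i t)) - V (p i) (dst (p i t)))"
      if "t \<in> C" for t
      using value_difference[OF pol(2,1) that] s(2)[OF that] unfolding P_def
      by (simp add: algebra_simps)
    show "V (p j) t - V (p i) t \<le> 0" if "t \<in> cyclic (p i)" for t
      using quiet_cyclic_values[OF assms(1-3) that] .
    show "V (p j) t - V (p i) t \<le> 0" if "t \<notin> C" for t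
      using V_outside pol that by simp
  qed (use that P_def in auto)
  then have "gap (p i) (p j) \<le> real n * (real n * P)"
    unfolding P_def by (intro gap_le) auto
  then have le: "gap (p i) (p j) \<le> real n ^ 2 * P" by (simp add: power2_eq_square)
  then have "P > 0" using assms(4) by (smt (verit) P_def mult_eq_0_iff)
  then show thesis using that[OF s(1)] le unfolding P_def by (simp add: max_def split: if_splits)
qed

lemma quiet_gap_decay:
  assumes "i \<le> j" "j \<le> b" "b \<le> L" "quiet i b"
  shows "gap (p j) (p b) \<le> (1 - 1 / real n ^ 2) ^ (j - i) * gap (p i) (p b)"
  using assms(1,2)
proof (induction j rule: dec_induct)
  case (step j)
  have j: "j < L" and q: "quiet j b" using step assms(3,4) unfolding quiet_def by auto
  have n2: "0 < real n ^ 2" "1 / real n ^ 2 \<le> 1" using n_ge by auto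
  have "gap (p j) (p b) \<le> real n ^ 2 * gain (p j) (a j)"
    using quiet_gap_le_gain[OF _ assms(3) q] step gain_max[OF j] gain_pos[OF j] by simp
  then have "gap (p j) (p b) / real n ^ 2 \<le> gain (p j) (a j)"
    using n2 by (simp add: field_simps)
  then have "gap (p (Suc j)) (p b) \<le> (1 - 1 / real n ^ 2) * gap (p j) (p b)"
    using gap_Suc_gain[OF j, of "p b"] by (simp add: algebra_simps)
  also have "\<dots> \<le> (1 - 1 / real n ^ 2) * ((1 - 1 / real n ^ 2) ^ (j - i) * gap (p i) (p b))"
    using step n2 by (intro mult_left_mono) auto
  finally show ?case using step by (simp add: Suc_diff_le)
qed simp

text \<open>
  Once the distance to the last policy has shrunk by more than \<open>n\<^sup>2\<close>, the action responsible for the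
  original distance has disappeared until the end of the stretch. The last policy can serve as the
  reference in \<open>loss_le_difference\<close> because it dominates the policies before it.
\<close>

lemma quiet_length:
  assumes l: "(1 - 1 / real n ^ 2) ^ l < 1 / real n ^ 2" "0 < l"
    and ab: "a0 \<le> b" "b \<le> L" "quiet a0 b"
  shows "b - a0 < (card moves + 1) * l"
proof (rule elimination_count[where c = "\<lambda>i. i" and L = "b - a0"
      and P = "\<lambda>i x. \<exists>s\<in>C. p (a0 + i) s = x", OF finite_moves l(2)])
  fix i' j' assume ij: "i' \<le> j'" "j' \<le> b - a0" "i' + l \<le> j'"
  define i j where "i = a0 + i'" and "j = a0 + j'"
  have i: "a0 \<le> i" "i < j" "i + l \<le> j" "j \<le> b" using ij l(2) ab(1) unfolding i_def j_def by auto
  have q: "quiet i b" using i ab(3) unfolding quiet_def by auto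
  have iL: "i < L" using i ab by simp
  have pos: "0 < gap (p i) (p b)"
    using gap_pos[OF iL, of "p b"] value_mono[of "Suc i" b] i ab by auto
  obtain s where s: "s \<in> C" "gap (p i) (p b) \<le> real n ^ 2 * (- gain (p b) (p i s))"
    using quiet_gap_le_loss[OF _ ab(2) q pos] i by auto
  have "\<not> (\<exists>t\<in>C. p k t = p i s)" if k: "j \<le> k" "k \<le> b" for k
  proof
    assume "\<exists>t\<in>C. p k t = p i s"
    then obtain t where t: "t \<in> C" "p k t = p i s" by auto
    have pol: "p i \<in> Pi C Act" "p k \<in> Pi C Act" "p b \<in> Pi C Act" using policy k i ab by auto
    have kb: "V (p k) x \<le> V (p b) x" for x using value_mono k ab by simp
    have "- gain (p b) (p k t) \<le> V (p b) t - V (p k) t"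
      by (rule loss_le_difference[OF pol(3,2) kb t(1)])
    also have "\<dots> \<le> gap (p k) (p b)" by (rule value_le_gap[OF t(1) kb])
    also have "\<dots> \<le> gap (p (i + l)) (p b)" using k i ab by (intro gap_mono) auto
    also have "\<dots> \<le> (1 - 1 / real n ^ 2) ^ l * gap (p i) (p b)"
      using quiet_gap_decay[of i "i + l" b] i ab q by simp
    also have "\<dots> < 1 / real n ^ 2 * gap (p i) (p b)"
      using l(1) pos by (rule mult_strict_right_mono)
    also have "\<dots> \<le> - gain (p b) (p i s)"
      using s(2) n_ge by (simp add: field_simps)
    finally show False using t(2) by simp
  qed
  moreover have "p i s \<in> moves" using policy_moves[OF policy s(1)] iL by simp
  ultimately show "\<exists>x\<in>moves. (\<exists>s\<in>C. p (a0 + i') s = x) \<and>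
      (\<forall>k. j' \<le> k \<and> k \<le> b - a0 \<longrightarrow> \<not> (\<exists>s\<in>C. p (a0 + k) s = x))"
    using s(1) ab(1) unfolding i_def j_def by (intro bexI[of _ "p (a0 + i') s"]) fastforce+
qed auto


subsection \<open>Pivots that create a cycle\<close>

lemma sum_cycle_difference:
  assumes "\<pi> \<in> Pi C Act" "\<rho> \<in> Pi C Act" "Z \<in> policy_cycles \<rho>"
  shows "(\<Sum>s\<in>Z. V \<rho> s - V \<pi> s) = (\<Sum>s\<in>Z. gain \<pi> (\<rho> s)) / (1 - \<gamma>)"
proof (rule sum_over_cycle[OF finite_C, where f = "\<lambda>s. dst (\<rho> s)"])
  show "Z \<in> cycles C (\<lambda>s. dst (\<rho> s))" using assms(3) unfolding policy_cycles_def .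
  then show "V \<rho> s - V \<pi> s = gain \<pi> (\<rho> s) + \<gamma> * (V \<rho> (dst (\<rho> s)) - V \<pi> (dst (\<rho> s)))"
    if "s \<in> Z" for s
    using value_difference[OF assms(1,2)] that cyclesD(1) by blast
qed (use discount in auto)

lemma sum_cycle_le_gap:
  assumes "Z \<subseteq> C" "\<And>s. V \<pi> s \<le> V \<rho> s"
  shows "(\<Sum>s\<in>Z. V \<rho> s - V \<pi> s) \<le> gap \<pi> \<rho>"
  unfolding gap_def using assms finite_C by (intro sum_mono2) auto

lemma cyclicE:
  assumes "s \<in> cyclic \<pi>"
  obtains Z where "Z \<in> policy_cycles \<pi>" "s \<in> Z" "Z \<subseteq> C" "finite Z"
  using assms cyclesD(1)[of _ C] finite_subset[OF _ finite_C]
  unfolding cyclic_def policy_cycles_def by blast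

text \<open>
  The switched state lies on a cycle of the new policy, and summing the value difference over this
  cycle collects the gain with the full factor \<open>1 / (1 - \<gamma>)\<close>.
\<close>

lemma creating_gain:
  assumes "i < L" "creating i"
  shows "gap (p (Suc i)) \<rho> \<le> gap (p i) \<rho> - gain (p i) (a i) / (1 - \<gamma>)"
proof -
  have pol: "p i \<in> Pi C Act" "p (Suc i) \<in> Pi C Act" using policy assms(1) by auto
  obtain Z where Z: "Z \<in> policy_cycles (p (Suc i))" "src (a i) \<in> Z" "Z \<subseteq> C" "finite Z"
    using cyclicE[OF assms(2)] .
  have g: "gain (p i) (p (Suc i) s) = (if s = src (a i) then gain (p i) (a i) else 0)"
    if "s \<in> C" for s
    using p_Suc[OF assms(1)] gain_own[OF pol(1) that] by simp
  have "gain (p i) (a i) \<le> (\<Sum>s\<in>Z. gain (p i) (p (Suc i) s))"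
    using member_le_sum[of "src (a i)" Z "\<lambda>s. gain (p i) (p (Suc i) s)"] Z g gain_pos[OF assms(1)]
    by (smt (verit) DiffD1 subsetD)
  then have "gain (p i) (a i) / (1 - \<gamma>) \<le> (\<Sum>s\<in>Z. V (p (Suc i)) s - V (p i) s)"
    unfolding sum_cycle_difference[OF pol Z(1)] using discount by (intro divide_right_mono) auto
  also have "\<dots> \<le> gap (p i) (p (Suc i))"
    using Z(3) value_Suc_ge[OF assms(1)] by (rule sum_cycle_le_gap)
  finally show ?thesis using gap_Suc[OF assms(1), of \<rho>] unfolding gap_def by linarith
qed

definition created :: "nat \<Rightarrow> nat" where
  "created i = card {k. k < i \<and> creating k}"

lemma created_0: "created 0 = 0"
  unfolding created_def by simp

lemma created_Suc: "created (Suc i) = created i + (if creating i then 1 else 0)"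
proof (cases "creating i")
  case True
  then have "{k. k < Suc i \<and> creating k} = insert i {k. k < i \<and> creating k}"
    by (auto simp: less_Suc_eq)
  then show ?thesis unfolding created_def using True by simp
next
  case False
  then have "{k. k < Suc i \<and> creating k} = {k. k < i \<and> creating k}"
    by (auto simp: less_Suc_eq)
  then show ?thesis unfolding created_def using False by simp
qed

lemma created_mono: "i \<le> j \<Longrightarrow> created i \<le> created j"
  unfolding created_def by (intro card_mono) auto

context
  fixes \<rho>
  assumes opt: "\<rho> \<in> Pi C Act" "\<And>b. b \<in> moves \<Longrightarrow> gain \<rho> b \<le> 0"
begin

lemma optimal_value_ge: "\<pi> \<in> Pi C Act \<Longrightarrow> V \<pi> s \<le> V \<rho> s"
  using value_difference_le[OF opt(1), of \<pi> 0 s] opt(2) policy_moves[of \<pi>] by simp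

text \<open>
  Pivots that create no cycle cannot increase the distance to the optimum, so only the creations are
  counted in the exponent.
\<close>

lemma optimal_gap_decay:
  assumes "i \<le> j" "j \<le> L"
  shows "gap (p j) \<rho> \<le> (1 - 1 / real n) ^ (created j - created i) * gap (p i) \<rho>"
  using assms
proof (induction j rule: dec_induct)
  case (step j)
  then have j: "j < L" and IH: "gap (p j) \<rho> \<le> (1 - 1 / real n) ^ (created j - created i) * gap (p i) \<rho>"
    by auto
  have n1: "0 < real n" "1 / real n \<le> 1" using n_ge by auto
  show ?case
  proof (cases "creating j")
    case False
    then show ?thesis
      using gap_mono[of j "Suc j" \<rho>] j IH by (simp add: created_Suc)
  next
    case True
    have pol: "p j \<in> Pi C Act" using policy j by simp
    have "V \<rho> s - V (p j) s \<le> gain (p j) (a j) / (1 - \<gamma>)" for s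
      using gain_pos[OF j] gain_max[OF j] policy_moves[OF opt(1)]
      by (intro value_difference_le[OF pol opt(1)]) auto
    then have "gap (p j) \<rho> \<le> real n * (gain (p j) (a j) / (1 - \<gamma>))"
      using gain_pos[OF j] discount by (intro gap_le) auto
    then have "gap (p j) \<rho> / real n \<le> gain (p j) (a j) / (1 - \<gamma>)"
      using n1 by (simp add: field_simps)
    then have "gap (p (Suc j)) \<rho> \<le> (1 - 1 / real n) * gap (p j) \<rho>"
      using creating_gain[OF j True, of \<rho>] by (simp add: algebra_simps)
    also have "\<dots> \<le> (1 - 1 / real n) * ((1 - 1 / real n) ^ (created j - created i) * gap (p i) \<rho>)"
      using IH n1 by (intro mult_left_mono) auto
    finally show ?thesis
      using True created_mono[of i j] step by (simp add: created_Suc Suc_diff_le)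
  qed
qed simp

text \<open>
  Part of the distance to the optimum stems from losses on paths, which count at most \<open>n\<close> times, and
  part from losses on cycles, which count \<open>1 / (1 - \<gamma>)\<close> times. One of the two parts contains an
  action with a large share. The factor \<open>4\<close> leaves each part at most a quarter of the distance in
  the proof by contradiction.
\<close>

lemma optimal_gap_le_loss:
  assumes "\<pi> \<in> Pi C Act" "0 < gap \<pi> \<rho>"
  obtains s where "s \<in> C" "gap \<pi> \<rho> \<le> 4 * real n ^ 2 * (- gain \<rho> (\<pi> s))"
  | s where "s \<in> cyclic \<pi>" "gap \<pi> \<rho> \<le> 4 * real n * (- gain \<rho> (\<pi> s) / (1 - \<gamma>))"
proof (rule ccontr)
  assume "\<not> thesis"
  then have path: "\<And>s. s \<in> C \<Longrightarrow> 4 * real n ^ 2 * (- gain \<rho> (\<pi> s)) < gap \<pi> \<rho>"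
    and cyc: "\<And>s. s \<in> cyclic \<pi> \<Longrightarrow> 4 * real n * (- gain \<rho> (\<pi> s) / (1 - \<gamma>)) < gap \<pi> \<rho>"
    using that by (auto simp: not_le[symmetric])
  define P where "P = gap \<pi> \<rho> / (4 * real n ^ 2)"
  define R where "R = gap \<pi> \<rho> / (4 * real n)"
  have n0: "0 < real n" using n_ge by simp
  have pos: "0 \<le> P" "0 \<le> R" unfolding P_def R_def using assms(2) by auto
  have diff: "V \<rho> s - V \<pi> s =
      - gain \<rho> (\<pi> s) + \<gamma> * (V \<rho> (dst (\<pi> s)) - V \<pi> (dst (\<pi> s)))" if "s \<in> C" for s
    using value_difference[OF opt(1) assms(1) that] by (simp add: algebra_simps)
  have cyc_le: "V \<rho> s - V \<pi> s \<le> R" if "s \<in> cyclic \<pi>" for s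
  proof -
    have "V \<rho> s - V \<pi> s \<le> (1 - \<gamma>) * R / (1 - \<gamma>)"
    proof (rule discounted_max_principle[where Z = "cyclic \<pi>" and \<gamma> = \<gamma> and f = "\<lambda>s. dst (\<pi> s)"
          and d = "\<lambda>s. V \<rho> s - V \<pi> s"])
      show "finite (cyclic \<pi>)" using finite_subset[OF cyclic_subset finite_C] .
      fix t assume t: "t \<in> cyclic \<pi>"
      have "- gain \<rho> (\<pi> t) \<le> (1 - \<gamma>) * R"
        using cyc[OF t] n0 discount unfolding R_def by (simp add: field_simps)
      then show "V \<rho> t - V \<pi> t \<le> (1 - \<gamma>) * R + \<gamma> * (V \<rho> (dst (\<pi> t)) - V \<pi> (dst (\<pi> t)))"
        using diff[of t] t cyclic_subset[of \<pi>] by auto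
    qed (use discount cyclic_closed that in auto)
    then show ?thesis using discount by simp
  qed
  have "V \<rho> s - V \<pi> s \<le> R + real n * P" if "s \<in> C" for s
  proof (rule transient_difference_bound[where \<pi> = \<pi> and d = "\<lambda>s. V \<rho> s - V \<pi> s",
        OF pos card_C])
    fix t assume t: "t \<in> C"
    have "- gain \<rho> (\<pi> t) \<le> P"
      using path[OF t] n0 unfolding P_def by (simp add: field_simps)
    then show "V \<rho> t - V \<pi> t \<le> P + \<gamma> * (V \<rho> (dst (\<pi> t)) - V \<pi> (dst (\<pi> t)))"
      using diff[OF t] by simp
  next
    show "V \<rho> t - V \<pi> t \<le> R" if "t \<notin> C" for t
      using V_outside assms(1) opt(1) that pos by simp
  qed (use cyc_le that in auto)
  then have "gap \<pi> \<rho> \<le> real n * (R + real n * P)"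
    using pos by (intro gap_le) auto
  also have "\<dots> = gap \<pi> \<rho> / 2"
    unfolding P_def R_def using n0 by (simp add: field_simps power2_eq_square)
  finally show False using assms(2) by simp
qed

text \<open>
  An action with a large loss on a path is too bad to be selected at all later on. For an action whose
  loss is large only after multiplication with \<open>1 / (1 - \<gamma>)\<close>, the conclusion is weaker: it is never
  again selected on a cycle. The elements being retired are therefore pairs of an action and a flag
  that asks for the action to lie on a cycle.
\<close>

lemma created_bound_optimal:
  assumes l: "(1 - 1 / real n) ^ l < 1 / (4 * real n ^ 2)" "0 < l"
  shows "created L < (2 * card moves + 1) * l"
proof -
  define uses :: "nat \<Rightarrow> 'a \<times> bool \<Rightarrow> bool" where
    "uses i xb \<longleftrightarrow> (\<exists>s\<in>C. p i s = fst xb \<and> (snd xb \<longrightarrow> s \<in> cyclic (p i)))" for i xb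
  have n1: "0 < real n" "1 / real n \<le> 1" "1 \<le> real n" using n_ge by auto
  have "created L < (card (moves \<times> (UNIV :: bool set)) + 1) * l"
  proof (rule elimination_count[where c = created and L = L and P = uses])
    fix i j assume ij: "i \<le> j" "j \<le> L" "created i + l \<le> created j"
    have "i \<noteq> j" using ij l(2) by auto
    then have iL: "i < L" using ij by simp
    have pol: "p k \<in> Pi C Act" if "k \<le> L" for k using policy that .
    have pos: "0 < gap (p i) \<rho>"
      using gap_pos[OF iL, of \<rho>] optimal_value_ge[OF pol[of "Suc i"]] iL by simp
    have later: "gap (p k) \<rho> < gap (p i) \<rho> / (4 * real n ^ 2)" if k: "j \<le> k" "k \<le> L" for k
    proof -
      have "l \<le> created k - created i" using ij(3) created_mono[OF k(1)] by simp
      then have "(1 - 1 / real n) ^ (created k - created i) \<le> (1 - 1 / real n) ^ l"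
        using n1 by (intro power_decreasing) auto
      also have "\<dots> < 1 / (4 * real n ^ 2)" by (rule l(1))
      finally have "(1 - 1 / real n) ^ (created k - created i) * gap (p i) \<rho>
          < 1 / (4 * real n ^ 2) * gap (p i) \<rho>"
        using pos by (intro mult_strict_right_mono)
      then show ?thesis using optimal_gap_decay[of i k] ij k by simp
    qed
    have loss: "- gain \<rho> (p k t) \<le> V \<rho> t - V (p k) t" "0 \<le> - gain \<rho> (p k t)"
      if "k \<le> L" "t \<in> C" for k t
      using loss_le_difference[OF opt(1) pol[OF that(1)] optimal_value_ge[OF pol[OF that(1)]] that(2)]
        opt(2)[OF policy_moves[OF pol[OF that(1)] that(2)]] by auto
    show "\<exists>x\<in>moves \<times> UNIV. uses i x \<and> (\<forall>k. j \<le> k \<and> k \<le> L \<longrightarrow> \<not> uses k x)"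
      using pol[OF less_imp_le[OF iL]] pos
    proof (cases rule: optimal_gap_le_loss)
      case (1 s)
      have "\<not> uses k (p i s, False)" if k: "j \<le> k" "k \<le> L" for k
      proof
        assume "uses k (p i s, False)"
        then obtain t where t: "t \<in> C" "p k t = p i s" unfolding uses_def by auto
        have "- gain \<rho> (p k t) \<le> gap (p k) \<rho>"
          using loss(1)[OF k(2) t(1)] value_le_gap[OF t(1) optimal_value_ge[OF pol[OF k(2)]]] by simp
        also have "\<dots> < gap (p i) \<rho> / (4 * real n ^ 2)" by (rule later[OF k])
        also have "\<dots> \<le> - gain \<rho> (p i s)" using 1(2) n1 by (simp add: field_simps)
        finally show False using t(2) by simp
      qed
      moreover have "uses i (p i s, False)" unfolding uses_def using 1(1) by auto
      moreover have "p i s \<in> moves" using policy_moves[OF pol 1(1)] iL by simp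
      ultimately show ?thesis by (intro bexI[of _ "(p i s, False)"]) auto
    next
      case (2 s)
      have sC: "s \<in> C" using 2(1) cyclic_subset by blast
      have "\<not> uses k (p i s, True)" if k: "j \<le> k" "k \<le> L" for k
      proof
        assume "uses k (p i s, True)"
        then obtain t where t: "t \<in> cyclic (p k)" "p k t = p i s" unfolding uses_def by auto
        obtain Z where Z: "Z \<in> policy_cycles (p k)" "t \<in> Z" "Z \<subseteq> C" "finite Z"
          using cyclicE[OF t(1)] .
        have "(\<Sum>x\<in>Z. V (p k) x - V \<rho> x) = (\<Sum>x\<in>Z. gain \<rho> (p k x)) / (1 - \<gamma>)"
          by (rule sum_cycle_difference[OF opt(1) pol[OF k(2)] Z(1)])
        then have sumZ: "(\<Sum>x\<in>Z. V \<rho> x - V (p k) x) = (\<Sum>x\<in>Z. - gain \<rho> (p k x)) / (1 - \<gamma>)"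
          unfolding sum_negf sum_subtractf by simp
        have "- gain \<rho> (p k t) \<le> (\<Sum>x\<in>Z. - gain \<rho> (p k x))"
          using Z loss(2)[OF k(2)] by (intro member_le_sum) auto
        then have "- gain \<rho> (p k t) / (1 - \<gamma>) \<le> (\<Sum>x\<in>Z. V \<rho> x - V (p k) x)"
          unfolding sumZ using discount by (intro divide_right_mono) auto
        also have "\<dots> \<le> gap (p k) \<rho>"
          by (rule sum_cycle_le_gap[OF Z(3) optimal_value_ge[OF pol[OF k(2)]]])
        also have "\<dots> < gap (p i) \<rho> / (4 * real n ^ 2)" by (rule later[OF k])
        also have "\<dots> \<le> gap (p i) \<rho> / (4 * real n)"
          using pos n1 self_le_power[of "real n" 2] by (intro divide_left_mono) auto
        also have "\<dots> \<le> - gain \<rho> (p i s) / (1 - \<gamma>)"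
          using 2(2) n1 by (simp add: pos_divide_le_eq mult.commute)
        finally show False using t(2) by simp
      qed
      moreover have "uses i (p i s, True)" unfolding uses_def using 2(1) sC by auto
      moreover have "p i s \<in> moves" using policy_moves[OF pol sC] iL by simp
      ultimately show ?thesis by (intro bexI[of _ "(p i s, True)"]) auto
    qed
  qed (use finite_moves l(2) created_0 created_Suc in auto)
  then show ?thesis by (simp add: card_cartesian_product mult.commute)
qed

end

lemma created_bound:
  assumes "(1 - 1 / real n) ^ l < 1 / (4 * real n ^ 2)" "0 < l"
  shows "created L < (2 * card moves + 1) * l"
  using optimal_policy_exists created_bound_optimal[OF _ _ assms] by metis


subsection \<open>Length of a run\<close>

text \<open>
  A new cycle must pass through the switched state, and cycles are disjoint, so at most one is
  created; a broken cycle is lost.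
\<close>

lemma card_policy_cycles_Suc:
  assumes "i < L"
  shows "card (policy_cycles (p (Suc i))) + (if breaking i \<and> \<not> creating i then 1 else 0)
    \<le> card (policy_cycles (p i)) + (if creating i then 1 else 0)"
proof -
  have fin: "finite (policy_cycles \<pi>)" for \<pi>
    unfolding policy_cycles_def by (rule finite_cycles[OF finite_C])
  show ?thesis
  proof (cases "creating i")
    case True
    obtain Z where Z: "Z \<in> policy_cycles (p (Suc i))" "src (a i) \<in> Z"
      using cyclicE[OF True] by blast
    have "Y \<in> insert Z (policy_cycles (p i))" if Y: "Y \<in> policy_cycles (p (Suc i))" for Y
    proof (cases "src (a i) \<in> Y")
      case True
      then have "Y = Z"
        using cycles_disjoint[of Y C _ Z] Y Z unfolding policy_cycles_def by blast
      then show ?thesis by simp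
    next
      case False
      then show ?thesis using cycles_Suc_avoiding[OF assms False] Y by simp
    qed
    then have "card (policy_cycles (p (Suc i))) \<le> card (insert Z (policy_cycles (p i)))"
      using fin by (intro card_mono) auto
    also have "\<dots> \<le> card (policy_cycles (p i)) + 1"
      using fin by (simp add: card_insert_if)
    finally show ?thesis using True by simp
  next
    case False
    have sub: "policy_cycles (p (Suc i)) \<subseteq> policy_cycles (p i)"
    proof
      fix Y assume Y: "Y \<in> policy_cycles (p (Suc i))"
      then have "src (a i) \<notin> Y" using False unfolding cyclic_def by blast
      then show "Y \<in> policy_cycles (p i)" using cycles_Suc_avoiding[OF assms] Y by simp
    qed
    show ?thesis
    proof (cases "breaking i")
      case True
      then obtain Z where "Z \<in> policy_cycles (p i)" "src (a i) \<in> Z"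
        using cyclicE by blast
      moreover from this have "Z \<notin> policy_cycles (p (Suc i))"
        using False unfolding cyclic_def by blast
      ultimately have "card (policy_cycles (p (Suc i))) < card (policy_cycles (p i))"
        using sub by (intro psubset_card_mono fin) blast
      then show ?thesis using False by simp
    next
      assume "\<not> breaking i"
      then show ?thesis using card_mono[OF fin sub] False by simp
    qed
  qed
qed

lemma broken_bound:
  assumes "i \<le> L"
  shows "card {k. k < i \<and> breaking k \<and> \<not> creating k} + card (policy_cycles (p i)) \<le> n + created i"
  using assms
proof (induction i)
  case 0
  have "card (policy_cycles (p 0)) \<le> n"
    unfolding policy_cycles_def using card_cycles_le[OF finite_C] card_C order_trans by blast
  then show ?case by simp
next
  case (Suc i)
  let ?B = "\<lambda>i. {k. k < i \<and> breaking k \<and> \<not> creating k}"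
  have "card (?B (Suc i)) \<le> card (?B i) + (if breaking i \<and> \<not> creating i then 1 else 0)"
  proof (cases "breaking i \<and> \<not> creating i")
    case True
    then have "?B (Suc i) = insert i (?B i)" by (auto simp: less_Suc_eq)
    then show ?thesis using True by simp
  next
    case False
    then have "?B (Suc i) = ?B i" by (auto simp: less_Suc_eq)
    then show ?thesis using False by simp
  qed
  then show ?case
    using Suc card_policy_cycles_Suc[of i] created_Suc[of i] by simp
qed

lemma events_bound:
  "card {k. k < L \<and> (creating k \<or> breaking k)} \<le> 2 * created L + n"
proof -
  have "{k. k < L \<and> (creating k \<or> breaking k)} =
      {k. k < L \<and> creating k} \<union> {k. k < L \<and> breaking k \<and> \<not> creating k}" by auto
  then have "card {k. k < L \<and> (creating k \<or> breaking k)} \<le>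
      created L + card {k. k < L \<and> breaking k \<and> \<not> creating k}"
    unfolding created_def by (simp add: card_Un_le)
  then show ?thesis using broken_bound[of L] by simp
qed

text \<open>
  The run is cut at the pivots that create or break a cycle. The step counts \<open>l1\<close> and \<open>l2\<close> are chosen
  so that the two contraction factors reach \<open>1 / n\<^sup>2\<close> and \<open>1 / (4 * n\<^sup>2)\<close>.
\<close>

theorem run_length:
  "real L \<le> 231 * real n ^ 3 * real (card moves) ^ 2 * (ln (real n))\<^sup>2"
proof (cases "L = 0")
  case True
  then show ?thesis by simp
next
  case False
  define x where "x = ln (real n)"
  define N where "N = real n"
  define m where "m = real (card moves)"
  have n2: "2 \<le> N" using n_ge unfolding N_def by simp
  have "moves \<noteq> {}" using a_move[of 0] False by auto
  then have "0 < card moves" using finite_moves by (simp add: card_gt_0_iff)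
  then have m1: "1 \<le> m" unfolding m_def by simp
  \<comment> \<open>\<open>ln n\<close> is bounded away from \<open>0\<close>, so that rounding and lower-order terms are absorbed.\<close>
  have "ln (1 / N) \<le> 1 / N - 1" using n2 by (intro ln_le_minus_one) simp
  then have "1 - 1 / N \<le> x" unfolding x_def N_def using n_ge by (simp add: ln_div)
  moreover have "1 / N \<le> 1 / 2" using n2 by simp
  ultimately have xh: "1 / 2 \<le> x" by linarith
  have Nx: "1 \<le> N * x" using mult_mono[of 2 N "1/2" x] n2 xh by simp
  then have NNx: "1 \<le> N ^ 2 * x"
    using mult_mono[of 1 N 1 "N * x"] n2 by (simp add: power2_eq_square mult.assoc)
  have expx: "exp x = N" unfolding x_def N_def using n_ge by simp
  define l1 where "l1 = nat \<lfloor>N ^ 2 * (2 * x)\<rfloor> + 1"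
  define l2 where "l2 = nat \<lfloor>N * (4 * x)\<rfloor> + 1"
  have l1: "N ^ 2 * (2 * x) < real l1" "real l1 \<le> 3 * (N ^ 2 * x)"
    unfolding l1_def using NNx by linarith+
  have l2: "N * (4 * x) < real l2" "real l2 \<le> 5 * (N * x)"
    unfolding l2_def using Nx by linarith+
  have "exp (- (2 * x)) = 1 / N ^ 2"
    using expx exp_of_nat_mult[of 2 x] by (simp add: exp_minus inverse_eq_divide)
  then have shrink1: "(1 - 1 / real n ^ 2) ^ l1 < 1 / real n ^ 2"
    using exp_scale_le[of "N ^ 2" "2 * x" l1] l1(1) n2 unfolding N_def by simp
  \<comment> \<open>\<open>N ^ 4\<close> instead of \<open>4 * N ^ 2\<close> avoids an extra logarithm.\<close>
  have "exp (- (4 * x)) = 1 / N ^ 4"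
    using expx exp_of_nat_mult[of 4 x] by (simp add: exp_minus inverse_eq_divide)
  also have "\<dots> \<le> 1 / (4 * N ^ 2)"
  proof -
    have "4 \<le> N ^ 2" using power_mono[of 2 N 2] n2 by simp
    then have "4 * N ^ 2 \<le> N ^ 2 * N ^ 2" by (intro mult_right_mono) auto
    then have "4 * N ^ 2 \<le> N ^ 4" by (simp flip: power_add)
    then show ?thesis using n2 by (intro divide_left_mono) auto
  qed
  finally have shrink2: "(1 - 1 / real n) ^ l2 < 1 / (4 * real n ^ 2)"
    using exp_scale_le[of N "4 * x" l2] l2(1) n2 unfolding N_def by simp
  have "L \<le> (card {k. k < L \<and> (creating k \<or> breaking k)} + 1) * ((card moves + 1) * l1 + 1)"
  proof (rule length_le_by_gaps)
    show "b - a0 \<le> (card moves + 1) * l1"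
      if "a0 \<le> b" "b \<le> L" "\<forall>k. a0 \<le> k \<and> k < b \<longrightarrow> \<not> (creating k \<or> breaking k)" for a0 b
      using quiet_length[OF shrink1 _ that(1,2)] that(3) unfolding quiet_def l1_def by simp
  qed
  also have "\<dots> \<le> (2 * created L + n + 1) * ((card moves + 1) * l1 + 1)"
    using events_bound by (intro mult_right_mono) auto
  also have "\<dots> \<le> (2 * ((2 * card moves + 1) * l2) + n + 1) * ((card moves + 1) * l1 + 1)"
    using created_bound[OF shrink2] unfolding l2_def by (intro mult_right_mono) auto
  finally have "real L \<le> real ((2 * ((2 * card moves + 1) * l2) + n + 1) * ((card moves + 1) * l1 + 1))"
    by (rule of_nat_mono)
  then have "real L \<le> (2 * ((2 * m + 1) * real l2) + N + 1) * ((m + 1) * real l1 + 1)"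
    unfolding m_def N_def by (simp add: algebra_simps)
  \<comment> \<open>The first factor bounds the number of stretches, the second one their length.\<close>
  also have "\<dots> \<le> (33 * (m * (N * x))) * (7 * (m * (N ^ 2 * x)))"
  proof (rule mult_mono)
    have "(2 * m + 1) * real l2 \<le> (3 * m) * (5 * (N * x))"
      using m1 l2(2) by (intro mult_mono) auto
    moreover have "N \<le> 2 * (m * (N * x))"
      using mult_mono[of 1 m "1/2" x] m1 xh n2 mult_left_mono[of 1 "2 * (m * x)" N]
      by (simp add: mult.left_commute)
    ultimately show "2 * ((2 * m + 1) * real l2) + N + 1 \<le> 33 * (m * (N * x))"
      using n2 by (simp only: mult.assoc)
    have "(m + 1) * real l1 \<le> (2 * m) * (3 * (N ^ 2 * x))"
      using m1 l1(2) by (intro mult_mono) auto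
    moreover have "1 \<le> m * (N ^ 2 * x)"
      using mult_mono[of 1 m 1 "N ^ 2 * x"] m1 NNx by simp
    ultimately show "(m + 1) * real l1 + 1 \<le> 7 * (m * (N ^ 2 * x))"
      by simp
  qed (use m1 Nx in auto)
  also have "\<dots> = 231 * N ^ 3 * m ^ 2 * x ^ 2"
    by (simp add: power2_eq_square power3_eq_cube)
  finally show ?thesis unfolding N_def m_def x_def .
qed

end


section \<open>Values in a game\<close>

text \<open>
  The boundary is absorbed into the map: every state outside \<open>C\<close> becomes a self-loop paying
  \<open>(1 - \<gamma>) * w s\<close> per step, whose discounted total is \<open>w s\<close>. The solution is then the discounted sum
  along the orbit.
\<close>

lemma discounted_value_exists:
  fixes r w :: "'s \<Rightarrow> real"
  assumes "finite C" "0 < \<gamma>" "\<gamma> < 1"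
  shows "\<exists>v. (\<forall>s\<in>C. v s = r s + \<gamma> * v (f s)) \<and> (\<forall>s. s \<notin> C \<longrightarrow> v s = w s)"
proof -
  define F where "F s = (if s \<in> C then f s else s)" for s
  define q where "q s = (if s \<in> C then r s else (1 - \<gamma>) * w s)" for s
  define v where "v s = (\<Sum>k. \<gamma> ^ k * q ((F ^^ k) s))" for s
  have sm: "summable (\<lambda>k. \<gamma> ^ k * q ((F ^^ k) s))" for s
  proof -
    have orbit: "(F ^^ k) s \<in> C \<union> f ` C \<union> {s}" for k
      by (induction k) (auto simp: F_def)
    define M where "M = Max ((\<lambda>t. \<bar>q t\<bar>) ` (C \<union> f ` C \<union> {s}))"
    have M: "\<bar>q ((F ^^ k) s)\<bar> \<le> M" for k
      unfolding M_def using orbit[of k] assms(1) by (intro Max_ge) auto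
    have "summable (\<lambda>k. M * \<gamma> ^ k)"
      using assms by (intro summable_mult summable_geometric) auto
    then show ?thesis
    proof (rule summable_comparison_test')
      show "norm (\<gamma> ^ k * q ((F ^^ k) s)) \<le> M * \<gamma> ^ k" for k
        using mult_left_mono[OF M[of k], of "\<gamma> ^ k"] assms by (simp add: abs_mult mult.commute)
    qed
  qed
  have rec: "v s = q s + \<gamma> * v (F s)" for s
  proof -
    have "v s = q s + (\<Sum>k. \<gamma> ^ Suc k * q ((F ^^ Suc k) s))"
      using suminf_split_head[OF sm[of s]] unfolding v_def by simp
    also have "(\<Sum>k. \<gamma> ^ Suc k * q ((F ^^ Suc k) s)) = (\<Sum>k. \<gamma> * (\<gamma> ^ k * q ((F ^^ k) (F s))))"
      by (simp add: funpow_Suc_right mult.assoc del: funpow.simps)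
    also have "\<dots> = \<gamma> * v (F s)"
      unfolding v_def by (rule suminf_mult[OF sm])
    finally show ?thesis .
  qed
  have "v s = w s" if "s \<notin> C" for s
  proof -
    have "(1 - \<gamma>) * v s = (1 - \<gamma>) * w s"
      using rec[of s] that unfolding F_def q_def by (simp add: algebra_simps)
    then show ?thesis using assms by simp
  qed
  moreover have "v s = r s + \<gamma> * v (f s)" if "s \<in> C" for s
    using rec[of s] that unfolding F_def q_def by simp
  ultimately show ?thesis by blast
qed

lemma discounted_value_unique:
  fixes v v' :: "'s \<Rightarrow> real"
  assumes "finite C" "0 < \<gamma>" "\<gamma> < 1"
    and "\<And>s. s \<in> C \<Longrightarrow> v s = r s + \<gamma> * v (f s)" "\<And>s. s \<in> C \<Longrightarrow> v' s = r s + \<gamma> * v' (f s)"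
    and "\<And>s. s \<notin> C \<Longrightarrow> v s = v' s"
  shows "v = v'"
proof
  fix s
  have le: "x s - y s \<le> 0"
    if "s \<in> C" and x: "\<And>s. s \<in> C \<Longrightarrow> x s = r s + \<gamma> * x (f s)"
      and y: "\<And>s. s \<in> C \<Longrightarrow> y s = r s + \<gamma> * y (f s)"
      and out: "\<And>s. s \<notin> C \<Longrightarrow> x s = y s" for x y :: "'s \<Rightarrow> real"
  proof -
    have "x s - y s \<le> 0 / (1 - \<gamma>)"
    proof (rule discounted_max_principle[where d = "\<lambda>s. x s - y s" and f = f and Z = C and \<gamma> = \<gamma>])
      show "x t - y t \<le> 0 + \<gamma> * (x (f t) - y (f t))" if "t \<in> C" for t
        using x[OF that] y[OF that] by (simp add: algebra_simps)
    qed (use assms(1-3) out that(1) in auto)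
    then show ?thesis by simp
  qed
  show "v s = v' s"
  proof (cases "s \<in> C")
    case True
    show ?thesis
      using le[OF True assms(4,5,6)] le[OF True assms(5,4) assms(6)[symmetric]] by simp
  qed (simp add: assms(6))
qed

lemma finite_states: "finite (states G)"
  unfolding states_def by simp

lemma finite_acts: "finite (acts G s)"
  unfolding acts_def actions_def by simp

lemma actsD: "a \<in> acts G s \<Longrightarrow> a \<in> actions G \<and> src G a = s"
  unfolding acts_def by simp

lemma dest_in_states: "tbdg G \<Longrightarrow> a \<in> actions G \<Longrightarrow> dest G a \<in> states G"
  unfolding tbdg_def by blast

lemma discount_bounds: "tbdg G \<Longrightarrow> 0 < discount G \<and> discount G < 1"
  unfolding tbdg_def by blast

lemma q_value_eq:
  assumes "tbdg G" "a \<in> actions G"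
  shows "q_value G v a = cost G a + discount G * v (dest G a)"
proof -
  have "(\<Sum>t\<in>states G. trans G a t * v t) = (\<Sum>t\<in>states G. if t = dest G a then v t else 0)"
    by (intro sum.cong) (auto simp: trans_def)
  also have "\<dots> = v (dest G a)"
    using dest_in_states[OF assms] finite_states by simp
  finally show ?thesis unfolding q_value_def by simp
qed

lemma q_value_policy:
  assumes "tbdg G" "\<pi> \<in> Pi C (acts G)" "s \<in> C"
  shows "q_value G v (\<pi> s) = cost G (\<pi> s) + discount G * v (dest G (\<pi> s))"
  using q_value_eq[OF assms(1)] assms(2,3) actsD by blast

lemma local_value:
  assumes "tbdg G" "C \<subseteq> states G" "\<pi> \<in> Pi C (acts G)"
  shows "s \<in> C \<Longrightarrow> local_value G C w \<pi> s = q_value G (local_value G C w \<pi>) (\<pi> s)"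
    and "s \<notin> C \<Longrightarrow> local_value G C w \<pi> s = w s"
proof -
  note q = q_value_policy[OF assms(1,3)]
  have fin: "finite C" using assms(2) finite_states finite_subset by blast
  have "\<exists>!v. (\<forall>s\<in>C. v s = q_value G v (\<pi> s)) \<and> (\<forall>s. s \<notin> C \<longrightarrow> v s = w s)"
  proof (rule ex_ex1I)
    show "\<exists>v. (\<forall>s\<in>C. v s = q_value G v (\<pi> s)) \<and> (\<forall>s. s \<notin> C \<longrightarrow> v s = w s)"
      using discounted_value_exists[OF fin, of "discount G" "\<lambda>s. cost G (\<pi> s)" "\<lambda>s. dest G (\<pi> s)" w]
        discount_bounds[OF assms(1)] q by simp
  next
    fix v v'
    assume v: "(\<forall>s\<in>C. v s = q_value G v (\<pi> s)) \<and> (\<forall>s. s \<notin> C \<longrightarrow> v s = w s)"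
      and v': "(\<forall>s\<in>C. v' s = q_value G v' (\<pi> s)) \<and> (\<forall>s. s \<notin> C \<longrightarrow> v' s = w s)"
    show "v = v'"
    proof (rule discounted_value_unique[OF fin])
      show "v s = cost G (\<pi> s) + discount G * v (dest G (\<pi> s))" if "s \<in> C" for s
        by (rule trans[OF conjunct1[OF v, THEN bspec, OF that] q[OF that, of v]])
      show "v' s = cost G (\<pi> s) + discount G * v' (dest G (\<pi> s))" if "s \<in> C" for s
        by (rule trans[OF conjunct1[OF v', THEN bspec, OF that] q[OF that, of v']])
      show "v s = v' s" if "s \<notin> C" for s using v v' that by simp
    qed (use discount_bounds[OF assms(1)] in auto)
  qed
  from theI'[OF this] have sol: "(\<forall>s\<in>C. local_value G C w \<pi> s = q_value G (local_value G C w \<pi>) (\<pi> s)) \<and>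
      (\<forall>s. s \<notin> C \<longrightarrow> local_value G C w \<pi> s = w s)"
    unfolding local_value_def .
  show "s \<in> C \<Longrightarrow> local_value G C w \<pi> s = q_value G (local_value G C w \<pi>) (\<pi> s)"
    by (rule conjunct1[OF sol, THEN bspec])
  show "s \<notin> C \<Longrightarrow> local_value G C w \<pi> s = w s"
    by (rule conjunct2[OF sol, THEN spec, THEN mp])
qed

lemma local_value_eqI:
  assumes "tbdg G" "C \<subseteq> states G" "\<pi> \<in> Pi C (acts G)"
    and "\<And>s. s \<in> C \<Longrightarrow> v s = q_value G v (\<pi> s)" "\<And>s. s \<notin> C \<Longrightarrow> v s = w s"
  shows "local_value G C w \<pi> = v"
proof -
  have a: "local_value G C w \<pi> s =
      cost G (\<pi> s) + discount G * local_value G C w \<pi> (dest G (\<pi> s))" if "s \<in> C" for s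
    using local_value(1)[OF assms(1-3) that, of w] 
      q_value_policy[OF assms(1,3) that, of "local_value G C w \<pi>"] by (rule trans)
  have b: "v s = cost G (\<pi> s) + discount G * v (dest G (\<pi> s))" if "s \<in> C" for s
    using assms(4)[OF that] q_value_policy[OF assms(1,3) that, of v] by (rule trans)
  have c: "local_value G C w \<pi> s = v s" if "s \<notin> C" for s
    using local_value(2)[OF assms(1-3) that] assms(5)[OF that] by simp
  have d: "finite C" by (rule finite_subset[OF assms(2) finite_states])
  show ?thesis
    using a b c discount_bounds[OF assms(1)]
    by (intro discounted_value_unique[OF d, where v = "local_value G C w \<pi>" and \<gamma> = "discount G"
          and r = "\<lambda>s. cost G (\<pi> s)" and f = "\<lambda>s. dest G (\<pi> s)"]) simp_all
qed
text \<open>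
  The sign \<open>\<epsilon>\<close> is \<open>1\<close> for the maximizing and \<open>- 1\<close> for the minimizing player.
\<close>

lemma game_control:
  assumes "tbdg G" "C \<subseteq> states G"
  shows "discounted_control C (acts G) (src G) (dest G) (\<lambda>a. \<epsilon> * cost G a) (discount G)
    (\<lambda>s. \<epsilon> * w s) (\<lambda>\<pi> s. \<epsilon> * local_value G C w \<pi> s)"
proof
  show "finite C" using finite_subset[OF assms(2) finite_states] .
  show "acts G s \<noteq> {}" if "s \<in> C" for s
    using assms that unfolding tbdg_def by blast
  show "\<epsilon> * local_value G C w \<pi> s =
      \<epsilon> * cost G (\<pi> s) + discount G * (\<epsilon> * local_value G C w \<pi> (dest G (\<pi> s)))"
    if "\<pi> \<in> Pi C (acts G)" "s \<in> C" for \<pi> s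
  proof -
    have "local_value G C w \<pi> s =
        cost G (\<pi> s) + discount G * local_value G C w \<pi> (dest G (\<pi> s))"
      by (rule trans[OF local_value(1)[OF assms that] q_value_policy[OF assms(1) that]])
    then show ?thesis by (simp add: distrib_left)
  qed
  show "\<epsilon> * local_value G C w \<pi> s = \<epsilon> * w s" if "\<pi> \<in> Pi C (acts G)" "s \<notin> C" for \<pi> s
    using local_value(2)[OF assms that] by simp
qed (use finite_acts actsD discount_bounds[OF assms(1)] in auto)

lemma game_gain:
  assumes "tbdg G" "C \<subseteq> states G" "a \<in> actions G"
  shows "discounted_control.gain (src G) (dest G) (\<lambda>a. \<epsilon> * cost G a) (discount G)
    (\<lambda>\<pi> s. \<epsilon> * local_value G C w \<pi> s) \<pi> a = \<epsilon> * reduced_cost G (local_value G C w \<pi>) a"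
  unfolding discounted_control.gain_def[OF game_control[OF assms(1,2)]] reduced_cost_def
    q_value_eq[OF assms(1,3)] by (simp add: algebra_simps)

definition pivot_step :: "game \<Rightarrow> nat set \<Rightarrow> (nat \<Rightarrow> real) \<Rightarrow> (nat \<Rightarrow> nat) \<Rightarrow> (nat \<Rightarrow> nat) \<Rightarrow> bool" where
  "pivot_step G C w \<pi> \<pi>' \<longleftrightarrow>
     (\<exists>a. most_improving G C (local_value G C w \<pi>) a \<and> \<pi>' = \<pi>(src G a := a))"

lemma comp_actionsD: "a \<in> comp_actions G C \<Longrightarrow> a \<in> actions G \<and> src G a \<in> C \<and> a \<in> acts G (src G a)"
  unfolding comp_actions_def acts_def by auto

lemma pivot_steps_policy:
  assumes "(pivot_step G C w ^^ L) \<pi> \<pi>'" "\<pi> \<in> Pi C (acts G)"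
  shows "\<pi>' \<in> Pi C (acts G)"
  using assms(1)
proof (induction L arbitrary: \<pi>')
  case (Suc L)
  then obtain \<pi>1 where 1: "(pivot_step G C w ^^ L) \<pi> \<pi>1" "pivot_step G C w \<pi>1 \<pi>'"
    by auto
  from 1(2) obtain a where a: "a \<in> comp_actions G C" "\<pi>' = \<pi>1(src G a := a)"
    unfolding pivot_step_def most_improving_def improving_def by auto
  show ?case using Suc.IH[OF 1(1)] comp_actionsD[OF a(1)] a(2) by auto
qed (simp add: assms(2))

text \<open>
  The parameter \<open>n\<close> is any bound on the number of states that is at least \<open>2\<close>: the logarithm of the
  size of the component itself would vanish for a single state.
\<close>

lemma component_run_length:
  assumes "tbdg G" "C \<subseteq> states G" "\<pi> \<in> Pi C (acts G)" "(pivot_step G C w ^^ L) \<pi> \<pi>'"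
    and "nstates G \<le> n" "2 \<le> n"
  shows "real L \<le> 231 * real n ^ 3 * real (card (comp_actions G C)) ^ 2 * (ln (real n))\<^sup>2"
proof -
  define \<epsilon> :: real where "\<epsilon> = (if C \<subseteq> player1 G then - 1 else 1)"
  interpret discounted_control C "acts G" "src G" "dest G" "\<lambda>a. \<epsilon> * cost G a" "discount G"
    "\<lambda>s. \<epsilon> * w s" "\<lambda>\<pi> s. \<epsilon> * local_value G C w \<pi> s"
    by (rule game_control[OF assms(1,2)])
  have moves: "moves = comp_actions G C" unfolding moves_def comp_actions_def ..
  have g: "gain \<pi> b = \<epsilon> * reduced_cost G (local_value G C w \<pi>) b" if "b \<in> comp_actions G C" for \<pi> b
    using comp_actionsD[OF that] by (intro game_gain[OF assms(1,2)]) simp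
  have piv: "\<exists>a. pivot \<pi> a \<pi>'" if st: "pivot_step G C w \<pi> \<pi>'" for \<pi> \<pi>'
  proof -
    from st obtain a where a: "improving G C (local_value G C w \<pi>) a"
      "\<forall>b\<in>comp_actions G C. if C \<subseteq> player1 G
         then reduced_cost G (local_value G C w \<pi>) a \<le> reduced_cost G (local_value G C w \<pi>) b
         else reduced_cost G (local_value G C w \<pi>) b \<le> reduced_cost G (local_value G C w \<pi>) a"
      "\<pi>' = \<pi>(src G a := a)"
      unfolding pivot_step_def most_improving_def by blast
    have mem: "a \<in> comp_actions G C" using a(1) unfolding improving_def by simp
    let ?r = "reduced_cost G (local_value G C w \<pi>)"
    have "0 < \<epsilon> * ?r a"
      using a(1) unfolding improving_def \<epsilon>_def by (auto split: if_splits)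
    moreover have "\<epsilon> * ?r b \<le> \<epsilon> * ?r a" if "b \<in> comp_actions G C" for b
      using a(2) that unfolding \<epsilon>_def by (auto split: if_splits)
    ultimately have "pivot \<pi> a \<pi>'"
      unfolding pivot_def moves using mem a(3) g by (intro conjI ballI) simp_all
    then show ?thesis ..
  qed
  obtain p where p: "p 0 = \<pi>" "\<And>i. i < L \<Longrightarrow> pivot_step G C w (p i) (p (Suc i))"
    using assms(4) unfolding relpowp_fun_conv by blast
  have "\<exists>a. \<forall>i. i < L \<longrightarrow> pivot (p i) (a i) (p (Suc i))"
    using piv[OF p(2)] by metis
  then obtain a where a: "\<And>i. i < L \<Longrightarrow> pivot (p i) (a i) (p (Suc i))" by blast
  have "card C \<le> card (states G)" by (rule card_mono[OF finite_states assms(2)])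
  also have "\<dots> \<le> n" unfolding states_def using assms(5) by simp
  finally interpret simplex_run C "acts G" "src G" "dest G" "\<lambda>a. \<epsilon> * cost G a" "discount G"
    "\<lambda>s. \<epsilon> * w s" "\<lambda>\<pi> s. \<epsilon> * local_value G C w \<pi> s" p a L n
    using p(1) assms(3,6) a by unfold_locales auto
  show ?thesis using run_length unfolding moves .
qed


section \<open>Optimality equations\<close>

definition solves_optimality :: "game \<Rightarrow> nat set \<Rightarrow> (nat \<Rightarrow> real) \<Rightarrow> (nat \<Rightarrow> nat) \<Rightarrow> bool" where
  "solves_optimality G D v \<pi> \<longleftrightarrow>
     (\<forall>s\<in>D. \<pi> s \<in> acts G s \<and> v s = q_value G v (\<pi> s) \<and>
        (\<forall>a\<in>acts G s. if s \<in> player1 G then v s \<le> q_value G v a else q_value G v a \<le> v s))"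

lemma value_vector_local:
  "value_vector G \<sigma> \<tau> = local_value G (states G) (\<lambda>_. undefined) (profile G \<sigma> \<tau>)"
proof -
  have "v \<in> extensional (states G) \<longleftrightarrow> (\<forall>s. s \<notin> states G \<longrightarrow> v s = undefined)" for v :: "nat \<Rightarrow> real"
    unfolding extensional_def by simp
  then show ?thesis unfolding value_vector_def local_value_def by (simp add: conj_commute)
qed

lemma profile_policy:
  assumes "\<sigma> \<in> strategies1 G" "\<tau> \<in> strategies2 G"
  shows "profile G \<sigma> \<tau> \<in> Pi (states G) (acts G)"
  using assms unfolding strategies1_def strategies2_def profile_def player2_def by auto

text \<open>
  For a fixed strategy of one player, a deviation of the other one has only gains of one sign with
  respect to the profile, so the values move in one direction.
\<close>

theorem optimality_equations_correct:
  assumes "tbdg G" "solves_optimality G (states G) v \<pi>"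
    and "\<And>s. s \<notin> states G \<Longrightarrow> v s = undefined"
  shows "correct_output G v \<pi>"
proof -
  define \<sigma> \<tau> where "\<sigma> = restrict \<pi> (player1 G)" and "\<tau> = restrict \<pi> (player2 G)"
  have sol: "\<pi> s \<in> acts G s" "v s = q_value G v (\<pi> s)" if "s \<in> states G" for s
    using assms(2) that unfolding solves_optimality_def by auto
  have p1: "player1 G \<subseteq> states G" using assms(1) unfolding tbdg_def by blast
  have st: "\<sigma> \<in> strategies1 G" "\<tau> \<in> strategies2 G"
    unfolding \<sigma>_def \<tau>_def strategies1_def strategies2_def using sol(1) p1
    by (auto simp: player2_def)
  have prof: "profile G \<sigma> \<tau> s = \<pi> s" if "s \<in> states G" for s
    unfolding profile_def \<sigma>_def \<tau>_def player2_def using that by simp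
  have vv: "value_vector G \<sigma> \<tau> = v"
    unfolding value_vector_local
    by (rule local_value_eqI[OF assms(1) order_refl profile_policy[OF st]])
      (use sol(2) prof assms(3) in auto)
  interpret discounted_control "states G" "acts G" "src G" "dest G" "\<lambda>a. 1 * cost G a" "discount G"
    "\<lambda>s. 1 * undefined" "\<lambda>\<pi> s. 1 * local_value G (states G) (\<lambda>_. undefined) \<pi> s"
    by (rule game_control[OF assms(1) order_refl])
  have gain: "gain (profile G \<sigma> \<tau>) b = q_value G v b - v s" if "b \<in> acts G s" for b s
    using game_gain[OF assms(1) order_refl, of b 1 "\<lambda>_. undefined" "profile G \<sigma> \<tau>"] actsD[OF that]
    unfolding vv[unfolded value_vector_local] reduced_cost_def by simp
  have "optimal G \<sigma> \<tau>"
    unfolding optimal_def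
  proof (intro conjI ballI st)
    fix \<tau>' s assume \<tau>': "\<tau>' \<in> strategies2 G" and "s \<in> states G"
    have "1 * value_vector G \<sigma> \<tau>' s - 1 * value_vector G \<sigma> \<tau> s \<le> 0 / (1 - discount G)"
      unfolding value_vector_local
    proof (rule value_difference_le[OF profile_policy[OF st] profile_policy[OF st(1) \<tau>']])
      fix t assume t: "t \<in> states G"
      have act: "profile G \<sigma> \<tau>' t \<in> acts G t"
        using profile_policy[OF st(1) \<tau>'] t by auto
      show "gain (profile G \<sigma> \<tau>) (profile G \<sigma> \<tau>' t) \<le> 0"
      proof (cases "t \<in> player1 G")
        case True
        then have "profile G \<sigma> \<tau>' t = \<pi> t" unfolding profile_def \<sigma>_def by simp
        then show ?thesis using gain[OF act] sol(2)[OF t] by simp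
      next
        case False
        then show ?thesis using gain[OF act] act assms(2) t unfolding solves_optimality_def by auto
      qed
    qed simp
    then show "value_vector G \<sigma> \<tau>' s \<le> value_vector G \<sigma> \<tau> s" by simp
  next
    fix \<sigma>' s assume \<sigma>': "\<sigma>' \<in> strategies1 G" and "s \<in> states G"
    have "1 * value_vector G \<sigma> \<tau> s \<le> 1 * value_vector G \<sigma>' \<tau> s"
      unfolding value_vector_local
    proof (rule value_difference_ge_0[OF profile_policy[OF st] profile_policy[OF \<sigma>' st(2)]])
      fix t assume t: "t \<in> states G"
      have act: "profile G \<sigma>' \<tau> t \<in> acts G t"
        using profile_policy[OF \<sigma>' st(2)] t by auto
      show "0 \<le> gain (profile G \<sigma> \<tau>) (profile G \<sigma>' \<tau> t)"
      proof (cases "t \<in> player1 G")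
        case True
        then show ?thesis using gain[OF act] act assms(2) t unfolding solves_optimality_def by auto
      next
        case False
        then have "profile G \<sigma>' \<tau> t = \<pi> t" unfolding profile_def \<tau>_def player2_def using t by simp
        then show ?thesis using gain[OF act] sol(2)[OF t] by simp
      qed
    qed
    then show "value_vector G \<sigma> \<tau> s \<le> value_vector G \<sigma>' \<tau> s" by simp
  qed
  then show ?thesis
    unfolding correct_output_def is_game_value_def using vv \<sigma>_def \<tau>_def by blast
qed


section \<open>Strongly connected components\<close>

lemma game_graph_simps:
  "verts (game_graph G) = states G" "arcs (game_graph G) = actions G"
  "tail (game_graph G) = src G" "head (game_graph G) = dest G"
  unfolding game_graph_def by simp_all

lemma game_graph_fin:
  assumes "tbdg G"
  shows "fin_digraph (game_graph G)"
proof
  show "finite (arcs (game_graph G))" unfolding game_graph_simps actions_def by simp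
qed (use assms finite_states in \<open>auto simp: game_graph_simps tbdg_def\<close>)

text \<open>
  A walk that leaves a set does so along some arc; the reachability of its ends allows the arc to be
  closed up to a cycle within a strongly connected component.
\<close>

lemma (in wf_digraph) awalk_leaves:
  assumes "awalk u q v" "u \<in> S" "v \<notin> S"
  shows "\<exists>e\<in>arcs G. tail G e \<in> S \<and> head G e \<notin> S \<and> u \<rightarrow>\<^sup>* tail G e \<and> head G e \<rightarrow>\<^sup>* v"
  using assms
proof (induction q arbitrary: u)
  case Nil
  then show ?case by (auto simp: awalk_Nil_iff)
next
  case (Cons e q)
  then have e: "e \<in> arcs G" "tail G e = u" "awalk (head G e) q v"
    by (auto simp: awalk_Cons_iff)
  have "(u, head G e) \<in> arcs_ends G" unfolding arcs_ends_conv using e(1,2) by blast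
  then have u: "u \<rightarrow>\<^sup>* head G e" by (rule reachable_adjI)
  show ?case
  proof (cases "head G e \<in> S")
    case True
    then show ?thesis using Cons.IH[OF e(3) True Cons.prems(3)] u reachable_trans by blast
  next
    case False
    have "u \<rightarrow>\<^sup>* u" using e(1,2) by auto
    then show ?thesis using False e Cons.prems(2) reachable_awalkI[OF e(3)] by auto
  qed
qed

text \<open>
  In a mixed component some arc goes from a state of Player 1 to a state of Player 2. A simple path
  back to its tail closes a simple cycle, and this path starts with an action of Player 2.
\<close>

lemma component_one_player:
  assumes "tbdfg G" "C \<in> pre_digraph.sccs_verts (game_graph G)"
  shows "C \<subseteq> player1 G \<or> C \<subseteq> player2 G"
proof (rule ccontr)
  assume neg: "\<not> (C \<subseteq> player1 G \<or> C \<subseteq> player2 G)"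
  have tb: "tbdg G" using assms(1) unfolding tbdfg_def by simp
  interpret fin_digraph "game_graph G" by (rule game_graph_fin[OF tb])
  have sub: "C \<subseteq> states G" using sccs_verts_subsets[OF assms(2)] unfolding game_graph_simps .
  from neg obtain u v where uv: "u \<in> C" "u \<in> player1 G" "v \<in> C" "v \<notin> player1 G"
    using sub unfolding player2_def by auto
  have conn: "x \<rightarrow>\<^sup>*\<^bsub>game_graph G\<^esub> y" if "x \<in> C" "y \<in> C" for x y
    using assms(2) that unfolding in_sccs_verts_conv_reachable by blast
  obtain q where "awalk u q v" using conn[OF uv(1,3)] unfolding reachable_awalk by blast
  from awalk_leaves[OF this uv(2,4)] obtain e where e: "e \<in> actions G"
    "src G e \<in> player1 G" "dest G e \<notin> player1 G"
    "u \<rightarrow>\<^sup>*\<^bsub>game_graph G\<^esub> src G e" "dest G e \<rightarrow>\<^sup>*\<^bsub>game_graph G\<^esub> v"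
    unfolding game_graph_simps by blast
  have "dest G e \<rightarrow>\<^sup>*\<^bsub>game_graph G\<^esub> src G e"
    using e(4,5) conn[OF uv(3,1)] reachable_trans by blast
  then obtain r where r: "apath (dest G e) r (src G e)" unfolding reachable_apath by blast
  have "r \<noteq> []" using r e(2,3) by (auto simp: apath_Nil_iff)
  then obtain b r' where br: "r = b # r'" by (cases r) auto
  have b: "b \<in> actions G" "src G b = dest G e"
    using r unfolding br apath_Cons_iff game_graph_simps by auto
  have "awalk (src G e) (e # r) (src G e)"
    using r e(1) unfolding awalk_Cons_iff game_graph_simps apath_def by simp
  moreover have "distinct (tl (awalk_verts (src G e) (e # r)))"
    using r unfolding apath_def by (simp add: game_graph_simps)
  ultimately have "cycle (e # r)" unfolding cycle_def by blast
  moreover have "src G b \<in> player2 G"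
    using b e(3) dest_in_states[OF tb e(1)] unfolding player2_def by simp
  ultimately show False
    using assms(1) e(2) br unfolding tbdfg_def by (metis list.set_intros)
qed

text \<open>
  Along an edge of the condensation graph the set of reachable states becomes strictly smaller, so
  sorting the components by its size gives a reverse topological order.
\<close>

lemma reverse_topological_exists:
  assumes "tbdg G"
  shows "\<exists>Cs. reverse_topological G Cs"
proof -
  interpret fin_digraph "game_graph G" by (rule game_graph_fin[OF assms])
  define R where "R C = {t. \<exists>s\<in>C. s \<rightarrow>\<^sup>*\<^bsub>game_graph G\<^esub> t}" for C
  have finR: "finite (R C)" for C
    by (rule finite_subset[OF _ finite_verts]) (auto simp: R_def reachable_in_verts)
  have dec: "card (R D) < card (R C)" if "condensation_edge G C D" for C D
  proof -
    from that obtain a where a: "C \<in> sccs_verts" "D \<in> sccs_verts" "C \<noteq> D"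
      "a \<in> actions G" "src G a \<in> C" "dest G a \<in> D"
      unfolding condensation_edge_def by blast
    have conn: "x \<rightarrow>\<^sup>*\<^bsub>game_graph G\<^esub> y" if "X \<in> sccs_verts" "x \<in> X" "y \<in> X" for X x y
      using that unfolding in_sccs_verts_conv_reachable by blast
    have adj: "src G a \<rightarrow>\<^sup>*\<^bsub>game_graph G\<^esub> dest G a"
      using a(4) by (intro reachable_adjI) (auto simp: arcs_ends_conv game_graph_simps)
    have to_D: "src G a \<rightarrow>\<^sup>*\<^bsub>game_graph G\<^esub> y" if "y \<in> D" for y
      using adj conn[OF a(2,6) that] reachable_trans by blast
    have "R D \<subseteq> R C"
      unfolding R_def using a(5) to_D reachable_trans by blast
    moreover have "src G a \<in> R C" unfolding R_def using conn[OF a(1,5,5)] a(5) by blast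
    moreover have "src G a \<notin> R D"
    proof
      assume "src G a \<in> R D"
      then obtain y where y: "y \<in> D" "y \<rightarrow>\<^sup>*\<^bsub>game_graph G\<^esub> src G a" unfolding R_def by blast
      have "y \<notin> C" using sccs_verts_disjoint[OF a(1-3)] y(1) by blast
      then show False
        using a(1,5) to_D[OF y(1)] y(2) unfolding in_sccs_verts_conv_reachable by blast
    qed
    ultimately show ?thesis by (intro psubset_card_mono finR) blast
  qed
  obtain xs where xs: "distinct xs" "set xs = sccs_verts"
    using finite_distinct_list[OF finite_sccs_verts] by blast
  define Cs where "Cs = sort_key (\<lambda>C. card (R C)) xs"
  have "i > j" if ij: "i < length Cs" "j < length Cs" "condensation_edge G (Cs ! i) (Cs ! j)" for i j
  proof (rule ccontr)
    assume "\<not> i > j"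
    then have "map (\<lambda>C. card (R C)) Cs ! i \<le> map (\<lambda>C. card (R C)) Cs ! j"
      using ij(2) unfolding Cs_def by (intro sorted_nth_mono[OF sorted_sort_key]) auto
    then show False using dec[OF ij(3)] ij(1,2) by simp
  qed
  then have "reverse_topological G Cs"
    unfolding reverse_topological_def using xs by (auto simp: Cs_def)
  then show ?thesis ..
qed

lemma reverse_topological_props:
  assumes "tbdg G" "reverse_topological G Xs"
  shows "\<Union> (set Xs) = states G"
    and "X \<in> set Xs \<Longrightarrow> Y \<in> set Xs \<Longrightarrow> X \<noteq> Y \<Longrightarrow> X \<inter> Y = {}"
proof -
  interpret fin_digraph "game_graph G" by (rule game_graph_fin[OF assms(1)])
  have eq: "set Xs = sccs_verts" using assms(2) unfolding reverse_topological_def by blast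
  show "X \<in> set Xs \<Longrightarrow> Y \<in> set Xs \<Longrightarrow> X \<noteq> Y \<Longrightarrow> X \<inter> Y = {}"
    unfolding eq by (rule sccs_verts_disjoint)
  show "\<Union> (set Xs) = states G"
    unfolding eq game_graph_simps(1)[symmetric]
    using sccs_verts_subsets scc_of_in_sccs_verts in_scc_of_self by blast
qed

text \<open>
  Everything reached from a processed component has been processed before. In particular the
  placeholder values of unprocessed states are never read.
\<close>

lemma prefix_closed:
  assumes "tbdg G" "reverse_topological G (Ds @ Es)" "s \<in> \<Union> (set Ds)" "a \<in> acts G s"
  shows "dest G a \<in> \<Union> (set Ds)"
proof -
  have a: "a \<in> actions G" "src G a = s" using actsD[OF assms(4)] by auto
  obtain C where C: "C \<in> set Ds" "s \<in> C" using assms(3) by blast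
  have "dest G a \<in> \<Union> (set (Ds @ Es))"
    using dest_in_states[OF assms(1) a(1)] reverse_topological_props(1)[OF assms(1,2)] by blast
  then obtain D where D: "D \<in> set (Ds @ Es)" "dest G a \<in> D" by blast
  show ?thesis
  proof (cases "D = C")
    case True
    then show ?thesis using C D by blast
  next
    case False
    obtain i where i: "i < length Ds" "Ds ! i = C" using C(1) by (auto simp: in_set_conv_nth)
    obtain j where j: "j < length (Ds @ Es)" "(Ds @ Es) ! j = D"
      using D(1) by (metis in_set_conv_nth)
    have Ci: "(Ds @ Es) ! i = C" "i < length (Ds @ Es)" using i by (auto simp: nth_append)
    have "condensation_edge G C D"
      unfolding condensation_edge_def using assms(2) C D False a
      unfolding reverse_topological_def by auto
    then have "j < i" using assms(2) Ci j unfolding reverse_topological_def by blast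
    then have "D \<in> set Ds" using i(1) j by (auto simp: nth_append)
    then show ?thesis using D(2) by blast
  qed
qed


section \<open>Runs of backward propagation\<close>

text \<open>
  Value vectors of the game are \<open>undefined\<close> outside the states, so the placeholder at unprocessed states
  is part of what has to be preserved.
\<close>

definition stored :: "game \<Rightarrow> nat set list \<Rightarrow> (nat \<Rightarrow> real) \<Rightarrow> (nat \<Rightarrow> nat) \<Rightarrow> bool" where
  "stored G Ds v \<pi> \<longleftrightarrow> solves_optimality G (\<Union> (set Ds)) v \<pi> \<and>
     (\<forall>s. s \<notin> \<Union> (set Ds) \<longrightarrow> v s = undefined)"

text \<open>
  The processed components are charged separately; \<open>n\<close> is a common bound on the number of states.
\<close>

definition pivot_budget :: "game \<Rightarrow> nat \<Rightarrow> nat set set \<Rightarrow> real" where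
  "pivot_budget G n \<X> =
     231 * real n ^ 3 * (ln (real n))\<^sup>2 * (\<Sum>X\<in>\<X>. real (card (comp_actions G X)) ^ 2)"

text \<open>
  The invariant of the algorithm. While a component is being solved, it remembers the whole run of the
  simplex method on this component, since the number of its pivots is bounded only through the
  run.
\<close>

fun consistent :: "game \<Rightarrow> nat \<Rightarrow> config \<Rightarrow> bool" where
  "consistent G n (Between Cs v \<pi> N) \<longleftrightarrow>
     (\<exists>Ds. reverse_topological G (Ds @ Cs) \<and> stored G Ds v \<pi> \<and>
        real N \<le> pivot_budget G n (set Ds))"
| "consistent G n (Solving C Cs v \<pi> N) \<longleftrightarrow>
     (\<exists>Ds \<pi>0 N0 L. reverse_topological G (Ds @ C # Cs) \<and> stored G Ds v \<pi> \<and>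
        (C \<subseteq> player1 G \<or> C \<subseteq> player2 G) \<and> \<pi>0 \<in> Pi C (acts G) \<and>
        (pivot_step G C v ^^ L) \<pi>0 \<pi> \<and> N = N0 + L \<and>
        real N0 \<le> pivot_budget G n (set Ds))"

lemma solves_optimality_cong:
  assumes "tbdg G" "solves_optimality G D v \<pi>"
    and closed: "\<And>s a. s \<in> D \<Longrightarrow> a \<in> acts G s \<Longrightarrow> dest G a \<in> D"
    and same: "\<And>s. s \<in> D \<Longrightarrow> v' s = v s" "\<And>s. s \<in> D \<Longrightarrow> \<pi>' s = \<pi> s"
  shows "solves_optimality G D v' \<pi>'"
proof -
  have q: "q_value G v' a = q_value G v a" if "s \<in> D" "a \<in> acts G s" for s a
    using q_value_eq[OF assms(1)] actsD[OF that(2)] same(1)[OF closed[OF that]] by simp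
  show ?thesis
    unfolding solves_optimality_def
  proof (intro ballI conjI)
    fix s assume s: "s \<in> D"
    have old: "\<pi> s \<in> acts G s" "v s = q_value G v (\<pi> s)"
      "\<forall>a\<in>acts G s. if s \<in> player1 G then v s \<le> q_value G v a else q_value G v a \<le> v s"
      using assms(2) s unfolding solves_optimality_def by auto
    show "\<pi>' s \<in> acts G s" using old(1) same(2)[OF s] by simp
    show "v' s = q_value G v' (\<pi>' s)"
      using old(2) same(1)[OF s] same(2)[OF s] q[OF s old(1)] by simp
    show "if s \<in> player1 G then v' s \<le> q_value G v' a else q_value G v' a \<le> v' s"
      if "a \<in> acts G s" for a
      using old(3) that q[OF s that] same(1)[OF s] by simp
  qed
qed

lemma stored_cong:
  assumes "tbdg G" "reverse_topological G (Ds @ Es)" "stored G Ds v \<pi>"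
    and "\<And>s. s \<in> \<Union> (set Ds) \<Longrightarrow> \<pi>' s = \<pi> s"
  shows "stored G Ds v \<pi>'"
proof -
  have "solves_optimality G (\<Union> (set Ds)) v \<pi>'"
  proof (rule solves_optimality_cong[OF assms(1)])
    show "solves_optimality G (\<Union> (set Ds)) v \<pi>" using assms(3) unfolding stored_def by blast
    show "\<And>s a. s \<in> \<Union> (set Ds) \<Longrightarrow> a \<in> acts G s \<Longrightarrow> dest G a \<in> \<Union> (set Ds)"
      by (rule prefix_closed[OF assms(1,2)])
  qed (simp_all add: assms(4))
  then show ?thesis using assms(3) unfolding stored_def by blast
qed

lemma head_disjoint:
  assumes "tbdg G" "reverse_topological G (Ds @ C # Cs)"
  shows "C \<subseteq> states G" "s \<in> C \<Longrightarrow> s \<notin> \<Union> (set Ds)"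
proof -
  show "C \<subseteq> states G" using reverse_topological_props(1)[OF assms] by auto
  have "C \<notin> set Ds" using assms(2) unfolding reverse_topological_def by auto
  then have "C \<inter> D = {}" if "D \<in> set Ds" for D
    using reverse_topological_props(2)[OF assms, of C D] that by auto
  then show "s \<in> C \<Longrightarrow> s \<notin> \<Union> (set Ds)" by blast
qed

lemma stored_append:
  assumes "tbdg G" "reverse_topological G (Ds @ C # Cs)" "stored G Ds v \<pi>"
    and "C \<subseteq> player1 G \<or> C \<subseteq> player2 G" "\<pi> \<in> Pi C (acts G)"
    and no: "\<not> (\<exists>a. improving G C (local_value G C v \<pi>) a)"
  shows "stored G (Ds @ [C]) (local_value G C v \<pi>) \<pi>"
proof -
  let ?v = "local_value G C v \<pi>"
  note disj = head_disjoint[OF assms(1,2)]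
  have out: "?v s = v s" if "s \<notin> C" for s
    by (rule local_value(2)[OF assms(1) disj(1) assms(5) that])
  have "solves_optimality G (\<Union> (set Ds)) ?v \<pi>"
  proof (rule solves_optimality_cong[OF assms(1)])
    show "solves_optimality G (\<Union> (set Ds)) v \<pi>" using assms(3) unfolding stored_def by blast
    show "\<And>s a. s \<in> \<Union> (set Ds) \<Longrightarrow> a \<in> acts G s \<Longrightarrow> dest G a \<in> \<Union> (set Ds)"
      by (rule prefix_closed[OF assms(1,2)])
    show "?v s = v s" if "s \<in> \<Union> (set Ds)" for s
      using disj(2)[of s] that by (intro out) blast
  qed (rule refl)
  moreover have "solves_optimality G C ?v \<pi>"
    unfolding solves_optimality_def
  proof (intro ballI conjI)
    fix s assume s: "s \<in> C"
    show "\<pi> s \<in> acts G s" using assms(5) s by auto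
    show "?v s = q_value G ?v (\<pi> s)" by (rule local_value(1)[OF assms(1) disj(1) assms(5) s])
    fix a assume a: "a \<in> acts G s"
    have "a \<in> comp_actions G C" "src G a = s"
      using a s actsD[OF a] unfolding comp_actions_def by auto
    moreover have "\<not> improving G C ?v a" using no by blast
    ultimately have ni: "if C \<subseteq> player1 G then 0 \<le> q_value G ?v a - ?v s else q_value G ?v a - ?v s \<le> 0"
      unfolding improving_def reduced_cost_def by (cases "C \<subseteq> player1 G") simp_all
    show "if s \<in> player1 G then ?v s \<le> q_value G ?v a else q_value G ?v a \<le> ?v s"
    proof (cases "C \<subseteq> player1 G")
      case True
      then show ?thesis using ni s by auto
    next
      case False
      then have "s \<notin> player1 G" using assms(4) s unfolding player2_def by auto
      then show ?thesis using ni False by simp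
    qed
  qed
  moreover have "\<Union> (set (Ds @ [C])) = \<Union> (set Ds) \<union> C" by auto
  ultimately have "solves_optimality G (\<Union> (set (Ds @ [C]))) ?v \<pi>"
    by (simp only: solves_optimality_def ball_Un)
  moreover have "?v s = undefined" if "s \<notin> \<Union> (set (Ds @ [C]))" for s
    using that out[of s] assms(3) unfolding stored_def by auto
  ultimately show ?thesis unfolding stored_def by blast
qed

lemma pivot_budget_insert:
  assumes "C \<notin> set Ds"
  shows "pivot_budget G n (insert C (set Ds)) = pivot_budget G n (set Ds) +
    231 * real n ^ 3 * real (card (comp_actions G C)) ^ 2 * (ln (real n))\<^sup>2"
  unfolding pivot_budget_def using assms by (simp add: algebra_simps)

lemma solving_budget:
  assumes "tbdg G" "nstates G \<le> n" "2 \<le> n" "reverse_topological G (Ds @ C # Cs)"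
    and "\<pi>0 \<in> Pi C (acts G)" "(pivot_step G C v ^^ L) \<pi>0 \<pi>"
    and "real N0 \<le> pivot_budget G n (set Ds)"
  shows "real (N0 + L) \<le> pivot_budget G n (set (Ds @ [C]))"
proof -
  have "C \<notin> set Ds" using assms(4) unfolding reverse_topological_def by auto
  moreover have "real L \<le> 231 * real n ^ 3 * real (card (comp_actions G C)) ^ 2 * (ln (real n))\<^sup>2"
    using component_run_length[OF assms(1) head_disjoint(1)[OF assms(1,4)] assms(5,6,2,3)] .
  ultimately show ?thesis using pivot_budget_insert[of C Ds G n] assms(7) by simp
qed

lemma consistent_SolvingI:
  assumes "reverse_topological G (Ds @ C # Cs)" "stored G Ds v \<pi>"
    "C \<subseteq> player1 G \<or> C \<subseteq> player2 G" "\<pi>0 \<in> Pi C (acts G)"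
    "(pivot_step G C v ^^ L) \<pi>0 \<pi>" "real N0 \<le> pivot_budget G n (set Ds)"
  shows "consistent G n (Solving C Cs v \<pi> (N0 + L))"
  unfolding consistent.simps
  by (rule exI[of _ Ds], rule exI[of _ \<pi>0], rule exI[of _ N0], rule exI[of _ L])
    (intro conjI refl assms)

lemma consistent_step:
  assumes "tbdg G" "nstates G \<le> n" "2 \<le> n" "step G c c'" "consistent G n c"
  shows "consistent G n c'"
  using assms(4,5)
proof cases
  case (start C \<pi>' \<pi> Cs v N)
  from assms(5) obtain Ds where Ds: "reverse_topological G (Ds @ C # Cs)" "stored G Ds v \<pi>"
    "real N \<le> pivot_budget G n (set Ds)"
    unfolding start(1) by auto
  have "stored G Ds v \<pi>'"
    using stored_cong[OF assms(1) Ds(1,2)] start(5) head_disjoint(2)[OF assms(1) Ds(1)] by blast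
  moreover have "\<pi>' \<in> Pi C (acts G)" using start(4) by blast
  moreover have "(pivot_step G C v ^^ 0) \<pi>' \<pi>'" by simp
  ultimately have "consistent G n (Solving C Cs v \<pi>' (N + 0))"
    using consistent_SolvingI[OF Ds(1) _ start(3) _ _ Ds(3)] by blast
  then show ?thesis unfolding start(2) by (simp only: add_0_right)
next
  case (pivot C v \<pi> a Cs N)
  from assms(5) obtain Ds \<pi>0 N0 L where inv: "reverse_topological G (Ds @ C # Cs)" "stored G Ds v \<pi>"
    "C \<subseteq> player1 G \<or> C \<subseteq> player2 G" "\<pi>0 \<in> Pi C (acts G)"
    "(pivot_step G C v ^^ L) \<pi>0 \<pi>" "N = N0 + L" "real N0 \<le> pivot_budget G n (set Ds)"
    unfolding pivot(1) by auto
  have "src G a \<in> C"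
    using pivot(3) comp_actionsD unfolding most_improving_def improving_def by blast
  then have "src G a \<notin> \<Union> (set Ds)" by (rule head_disjoint(2)[OF assms(1) inv(1)])
  then have "stored G Ds v (\<pi>(src G a := a))"
    by (intro stored_cong[OF assms(1) inv(1,2)]) auto
  moreover have "(pivot_step G C v ^^ Suc L) \<pi>0 (\<pi>(src G a := a))"
    using inv(5) pivot(3) unfolding pivot_step_def by auto
  ultimately have "consistent G n (Solving C Cs v (\<pi>(src G a := a)) (N0 + Suc L))"
    using consistent_SolvingI[OF inv(1) _ inv(3,4) _ inv(7)] by blast
  then show ?thesis unfolding pivot(2) inv(6) by (simp only: add_Suc_right)
next
  case (finish C v \<pi> Cs N)
  from assms(5) obtain Ds \<pi>0 N0 L where inv: "reverse_topological G (Ds @ C # Cs)" "stored G Ds v \<pi>"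
    "C \<subseteq> player1 G \<or> C \<subseteq> player2 G" "\<pi>0 \<in> Pi C (acts G)"
    "(pivot_step G C v ^^ L) \<pi>0 \<pi>" "N = N0 + L" "real N0 \<le> pivot_budget G n (set Ds)"
    unfolding finish(1) by auto
  have "\<pi> \<in> Pi C (acts G)" by (rule pivot_steps_policy[OF inv(5,4)])
  then have "stored G (Ds @ [C]) (local_value G C v \<pi>) \<pi>"
    using stored_append[OF assms(1) inv(1-3)] finish(3) by blast
  moreover have "real N \<le> pivot_budget G n (set (Ds @ [C]))"
    unfolding inv(6) by (rule solving_budget[OF assms(1-3) inv(1,4,5,7)])
  moreover have "reverse_topological G ((Ds @ [C]) @ Cs)" using inv(1) by simp
  ultimately show ?thesis
    unfolding finish(2) consistent.simps by (intro exI[of _ "Ds @ [C]"] conjI)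
qed

lemma reachable_consistent:
  assumes "tbdg G" "nstates G \<le> n" "2 \<le> n" "reachable_config G c"
  shows "consistent G n c"
proof -
  from assms(4) obtain c0 where c0: "initial G c0" "(step G)\<^sup>*\<^sup>* c0 c"
    unfolding reachable_config_def by blast
  obtain Cs where Cs: "reverse_topological G Cs"
    "c0 = Between Cs (\<lambda>_. undefined) (\<lambda>_. undefined) 0"
    using c0(1) unfolding initial_def by blast
  have "stored G [] (\<lambda>_. undefined) (\<lambda>_. undefined)"
    unfolding stored_def solves_optimality_def by simp
  then have "consistent G n c0"
    unfolding Cs(2) consistent.simps using Cs(1)
    by (intro exI[of _ "[]"]) (simp add: pivot_budget_def)
  with c0(2) show ?thesis
  proof (induction rule: rtranclp_induct)
    case (step c c')
    then show ?case using consistent_step[OF assms(1-3) step.hyps(2)] by blast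
  qed
qed

lemma pivot_budget_le:
  assumes "tbdg G" "reverse_topological G Xs" "\<X> \<subseteq> set Xs"
  shows "pivot_budget G n \<X> \<le> 231 * real n ^ 3 * real (nactions G) ^ 2 * (ln (real n))\<^sup>2"
proof -
  have fin: "finite \<X>" using assms(3) finite_subset by blast
  have fin': "finite (comp_actions G X)" for X
    by (rule finite_subset[of _ "actions G"]) (auto simp: comp_actions_def acts_def actions_def)
  have disj: "comp_actions G X \<inter> comp_actions G Y = {}" if "X \<in> \<X>" "Y \<in> \<X>" "X \<noteq> Y" for X Y
  proof -
    have "X \<inter> Y = {}" using reverse_topological_props(2)[OF assms(1,2)] that assms(3) by blast
    then show ?thesis unfolding comp_actions_def acts_def by auto
  qed
  have "(\<Sum>X\<in>\<X>. card (comp_actions G X)) = card (\<Union>X\<in>\<X>. comp_actions G X)"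
    using fin fin' disj by (intro card_UN_disjoint[symmetric]) auto
  also have "\<dots> \<le> card (actions G)"
    by (intro card_mono) (auto simp: comp_actions_def acts_def actions_def)
  also have "\<dots> = nactions G" unfolding actions_def by simp
  finally have total: "(\<Sum>X\<in>\<X>. real (card (comp_actions G X))) \<le> real (nactions G)"
    by (simp flip: of_nat_sum)
  have "(\<Sum>X\<in>\<X>. real (card (comp_actions G X)) ^ 2)
      \<le> (\<Sum>X\<in>\<X>. real (nactions G) * real (card (comp_actions G X)))"
  proof (rule sum_mono)
    fix X assume "X \<in> \<X>"
    then have "real (card (comp_actions G X)) \<le> (\<Sum>X\<in>\<X>. real (card (comp_actions G X)))"
      using fin by (intro member_le_sum) auto
    then show "real (card (comp_actions G X)) ^ 2
        \<le> real (nactions G) * real (card (comp_actions G X))"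
      unfolding power2_eq_square using total by (intro mult_right_mono) auto
  qed
  also have "\<dots> \<le> real (nactions G) * real (nactions G)"
    unfolding sum_distrib_left[symmetric] using total by (intro mult_left_mono) auto
  finally have "pivot_budget G n \<X> \<le>
      231 * real n ^ 3 * (ln (real n))\<^sup>2 * (real (nactions G) * real (nactions G))"
    unfolding pivot_budget_def by (intro mult_left_mono) auto
  then show ?thesis by (simp add: power2_eq_square algebra_simps)
qed

theorem pivot_bound:
  assumes "tbdg G" "nstates G \<le> n" "2 \<le> n" "reachable_config G c"
  shows "real (pivots c) \<le> 231 * real n ^ 3 * real (nactions G) ^ 2 * (ln (real n))\<^sup>2"
proof (cases c)
  case (Between Cs v \<pi> N)
  with reachable_consistent[OF assms] obtain Ds where
    "reverse_topological G (Ds @ Cs)" "real N \<le> pivot_budget G n (set Ds)"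
    by auto
  then show ?thesis
    using pivot_budget_le[OF assms(1), of "Ds @ Cs" "set Ds" n] Between by simp
next
  case (Solving C Cs v \<pi> N)
  with reachable_consistent[OF assms] obtain Ds \<pi>0 N0 L where
    inv: "reverse_topological G (Ds @ C # Cs)" "\<pi>0 \<in> Pi C (acts G)"
    "(pivot_step G C v ^^ L) \<pi>0 \<pi>" "N = N0 + L" "real N0 \<le> pivot_budget G n (set Ds)"
    by auto
  have "real N \<le> pivot_budget G n (set (Ds @ [C]))"
    unfolding inv(4) by (rule solving_budget[OF assms(1-3) inv(1,2,3,5)])
  also have "\<dots> \<le> 231 * real n ^ 3 * real (nactions G) ^ 2 * (ln (real n))\<^sup>2"
    by (rule pivot_budget_le[OF assms(1) inv(1)]) auto
  finally show ?thesis using Solving by simp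
qed

text \<open>
  A termination measure, given a bound \<open>M\<close> on the number of pivots: each component still to be
  processed accounts for one start and one end, and each remaining pivot for one step.
\<close>

fun remaining :: "nat \<Rightarrow> config \<Rightarrow> nat" where
  "remaining M (Between Cs v \<pi> N) = 2 * length Cs + (M - N)"
| "remaining M (Solving C Cs v \<pi> N) = 2 * length Cs + 1 + (M - N)"

lemma remaining_decreases:
  assumes "step G c c'" "pivots c' \<le> M"
  shows "remaining M c' < remaining M c"
  using assms by cases auto

lemma no_infinite_run:
  assumes "tbdg G"
  shows "\<not> infinite_run G f"
proof
  assume run: "infinite_run G f"
  \<comment> \<open>The maximum covers games with fewer than two states, which have to terminate as well.\<close>
  define n where "n = max 2 (nstates G)"
  define M where "M = nat \<lceil>231 * real n ^ 3 * real (nactions G) ^ 2 * (ln (real n))\<^sup>2\<rceil>"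
  have reach: "reachable_config G (f i)" for i
  proof -
    have "(step G)\<^sup>*\<^sup>* (f 0) (f i)"
      using run unfolding infinite_run_def by (induction i) (auto intro: rtranclp.rtrancl_into_rtrancl)
    then show ?thesis using run unfolding reachable_config_def infinite_run_def by blast
  qed
  have "pivots (f i) \<le> M" for i
  proof -
    have "real (pivots (f i)) \<le> 231 * real n ^ 3 * real (nactions G) ^ 2 * (ln (real n))\<^sup>2"
      by (rule pivot_bound[OF assms _ _ reach]) (simp_all add: n_def)
    then show ?thesis unfolding M_def by linarith
  qed
  then have "remaining M (f (Suc i)) < remaining M (f i)" for i
    using remaining_decreases[of G "f i"] run unfolding infinite_run_def by blast
  then show False
    using wf_measure[of "remaining M"] unfolding wf_iff_no_infinite_down_chain by auto
qed

text \<open>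
  A run cannot get stuck early: an improving action implies a most improving one, and the next
  component belongs to one player, so it can be started.
\<close>

lemma run_ends_correctly:
  assumes "tbdfg G" "reachable_config G c" "\<not> (\<exists>c'. step G c c')"
  shows "\<exists>v \<pi> N. c = Between [] v \<pi> N \<and> correct_output G v \<pi>"
proof -
  have tb: "tbdg G" using assms(1) unfolding tbdfg_def by simp
  have con: "consistent G (max 2 (nstates G)) c"
    by (rule reachable_consistent[OF tb _ _ assms(2)]) auto
  show ?thesis
  proof (cases c)
    case (Solving C Cs v \<pi> N)
    have "\<exists>a. improving G C (local_value G C v \<pi>) a"
      using assms(3) step.finish unfolding Solving by blast
    then obtain a where a: "improving G C (local_value G C v \<pi>) a" ..
    define \<epsilon> :: real where "\<epsilon> = (if C \<subseteq> player1 G then - 1 else 1)"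
    let ?r = "\<lambda>b. \<epsilon> * reduced_cost G (local_value G C v \<pi>) b"
    have "finite (comp_actions G C)"
      by (rule finite_subset[of _ "actions G"]) (auto simp: comp_actions_def acts_def actions_def)
    moreover have "a \<in> comp_actions G C" using a unfolding improving_def by simp
    ultimately obtain b where b: "b \<in> comp_actions G C"
      "\<And>x. x \<in> comp_actions G C \<Longrightarrow> ?r x \<le> ?r b"
      using finite_maximizer[of "comp_actions G C" ?r] by blast
    have "0 < ?r a" using a unfolding improving_def \<epsilon>_def by (auto split: if_splits)
    then have "0 < ?r b" using b(2)[OF \<open>a \<in> comp_actions G C\<close>] by simp
    then have "most_improving G C (local_value G C v \<pi>) b"
      using b unfolding most_improving_def improving_def \<epsilon>_def by (auto split: if_splits)
    then show ?thesis using assms(3) step.pivot unfolding Solving by blast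
  next
    case (Between Cs v \<pi> N)
    with con obtain Ds where Ds: "reverse_topological G (Ds @ Cs)" "stored G Ds v \<pi>" by auto
    show ?thesis
    proof (cases Cs)
      case Nil
      have D: "\<Union> (set Ds) = states G"
        using reverse_topological_props(1)[OF tb] Ds(1) Nil by simp
      then have "correct_output G v \<pi>"
        using Ds(2) unfolding stored_def D by (intro optimality_equations_correct[OF tb]) auto
      then show ?thesis using Between Nil by blast
    next
      case (Cons C Cs')
      have C: "C \<in> pre_digraph.sccs_verts (game_graph G)"
        using Ds(1) Cons unfolding reverse_topological_def by auto
      have "C \<subseteq> states G" using head_disjoint(1)[OF tb] Ds(1) Cons by blast
      then have ne: "\<forall>s\<in>C. acts G s \<noteq> {}" using tb unfolding tbdg_def by blast
      define \<pi>' where "\<pi>' s = (if s \<in> C then SOME a. a \<in> acts G s else \<pi> s)" for s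
      have "step G (Between (C # Cs') v \<pi> N) (Solving C Cs' v \<pi>' N)"
        using component_one_player[OF assms(1) C] ne
        by (intro step.start) (auto simp: \<pi>'_def some_in_eq)
      then show ?thesis using assms(3) Between Cons by blast
    qed
  qed
qed

theorem theorem2:
  shows "\<exists>K::real. \<forall>G. tbdfg G \<longrightarrow>
    correctly_computes G \<and>
    (2 \<le> nstates G \<longrightarrow>
      (\<forall>c. reachable_config G c \<longrightarrow>
         real (pivots c) \<le>
           K * real (nstates G) ^ 3 * real (nactions G) ^ 2 * (ln (real (nstates G)))\<^sup>2))"
proof (intro exI allI impI conjI)
  fix G assume G: "tbdfg G"
  then have tb: "tbdg G" unfolding tbdfg_def by simp
  have "\<exists>c. initial G c" using reverse_topological_exists[OF tb] unfolding initial_def by blast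
  then show "correctly_computes G"
    unfolding correctly_computes_def using no_infinite_run[OF tb] run_ends_correctly[OF G] by blast
  show "real (pivots c) \<le>
      231 * real (nstates G) ^ 3 * real (nactions G) ^ 2 * (ln (real (nstates G)))\<^sup>2"
    if "2 \<le> nstates G" "reachable_config G c" for c
    by (rule pivot_bound[OF tb order_refl that])
qed

end
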